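(* Let $R$ be a Noetherian commutative ring, let $S$ be a commutative Noetherian ring which is an $R$-algebra, let $I$ be an ideal of $S[[q_1,\dots,q_k]]$, and set $M=S[[q_1,\dots,q_k]]/I$. Let $A=R[[q_1,\dots,q_k]]\subset S[[q_1,\dots,q_k]]$ and $\mathfrak a=\langle q_1,\dots,q_k\rangle\subset A$. If $M/\mathfrak aM$ is a finitely generated $A/\mathfrak a$-module, then: (1) $M$ is a finitely generated $A$-module; (2) $M$ is $\mathfrak a$-adically complete.
   Context: All rings are commutative with $1$. $M$ is regarded as an $A$-module through $A\to S[[q_1,\dots,q_k]]\to M$. "$\mathfrak a$-adically complete" means that the natural map $M\to\varprojlim_n M/\mathfrak a^nM$ is an isomorphism. *)

theory Defs
  imports "HOL-Algebra.Ring_Divisibility" "HOL-Algebra.Ideal_Product" "HOL-Algebra.Module"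
begin

section \<open>Power series in finitely many variables\<close>

text \<open>
  As in \<open>HOL-Algebra.Indexed_Polynomials\<close>, a monomial is a multiset of variable indices:
  the multiset \<open>m\<close> stands for the product over \<open>i\<close> of the powers of \<open>q\<^sub>i\<close> with exponent
  \<open>count m i\<close>.  A power series over \<open>R\<close> in \<open>q\<^sub>1, \<dots>, q\<^sub>k\<close> is its coefficient function, which is
  \<open>\<zero>\<close> at every monomial involving a variable with index outside \<open>{1..k}\<close>.
\<close>

definition power_series :: "('a, 'b) ring_scheme \<Rightarrow> nat \<Rightarrow> (nat multiset \<Rightarrow> 'a) ring" where
  "power_series R k =
    \<lparr>carrier = {f. (\<forall>m. f m \<in> carrier R) \<and> (\<forall>m. \<not> set_mset m \<subseteq> {1..k} \<longrightarrow> f m = \<zero>\<^bsub>R\<^esub>)},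
     mult = (\<lambda>f g m. \<Oplus>\<^bsub>R\<^esub>n\<in>{n. n \<subseteq># m}. f n \<otimes>\<^bsub>R\<^esub> g (m - n)),
     one = (\<lambda>m. if m = {#} then \<one>\<^bsub>R\<^esub> else \<zero>\<^bsub>R\<^esub>),
     zero = (\<lambda>m. \<zero>\<^bsub>R\<^esub>),
     add = (\<lambda>f g m. f m \<oplus>\<^bsub>R\<^esub> g m)\<rparr>"

definition ps_var :: "('a, 'b) ring_scheme \<Rightarrow> nat \<Rightarrow> nat multiset \<Rightarrow> 'a" where
  "ps_var R i = (\<lambda>m. if m = {#i#} then \<one>\<^bsub>R\<^esub> else \<zero>\<^bsub>R\<^esub>)"

definition var_ideal :: "('a, 'b) ring_scheme \<Rightarrow> nat \<Rightarrow> (nat multiset \<Rightarrow> 'a) set" where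
  "var_ideal R k = Idl\<^bsub>power_series R k\<^esub> (ps_var R ` {1..k})"

text \<open>The map \<open>R[[q\<^sub>1, \<dots>, q\<^sub>k]] \<rightarrow> S[[q\<^sub>1, \<dots>, q\<^sub>k]]\<close> induced by the structure map
  \<open>r \<mapsto> r \<odot> \<one>\<close> of an \<open>R\<close>-algebra \<open>S\<close>.\<close>

definition ps_structure_map ::
    "('r, 's, 'm) module_scheme \<Rightarrow> (nat multiset \<Rightarrow> 'r) \<Rightarrow> nat multiset \<Rightarrow> 's" where
  "ps_structure_map S f = (\<lambda>m. f m \<odot>\<^bsub>S\<^esub> \<one>\<^bsub>S\<^esub>)"


section \<open>Modules\<close>

text \<open>The ring \<open>B\<close> regarded as a module along a ring homomorphism \<open>h\<close> into \<open>B\<close>.\<close>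

definition module_along :: "('b, 'c) ring_scheme \<Rightarrow> ('a \<Rightarrow> 'b) \<Rightarrow> ('a, 'b) module" where
  "module_along B h =
    \<lparr>carrier = carrier B, mult = mult B, one = one B, zero = zero B, add = add B,
     smult = (\<lambda>a x. h a \<otimes>\<^bsub>B\<^esub> x)\<rparr>"

definition gen_submodule ::
    "('a, 'b) ring_scheme \<Rightarrow> ('a, 'm, 'c) module_scheme \<Rightarrow> 'm set \<Rightarrow> 'm set" where
  "gen_submodule A M X = \<Inter>{N. submodule N A M \<and> X \<subseteq> N}"

locale fin_gen_module = module +
  assumes finitely_generated: "\<exists>X \<subseteq> carrier M. finite X \<and> carrier M = gen_submodule R M X"

definition ideal_smult ::
    "('a, 'b) ring_scheme \<Rightarrow> ('a, 'm, 'c) module_scheme \<Rightarrow> 'a set \<Rightarrow> 'm set" where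
  "ideal_smult A M J = gen_submodule A M {a \<odot>\<^bsub>M\<^esub> x | a x. a \<in> J \<and> x \<in> carrier M}"

text \<open>The counterpart of \<^const>\<open>rcoset_mult\<close> for scalar multiplication.\<close>

definition rcoset_smult ::
    "('a, 'm, 'c) module_scheme \<Rightarrow> 'm set \<Rightarrow> 'a set \<Rightarrow> 'm set \<Rightarrow> 'm set" where
  "rcoset_smult M N X Y = (\<Union>a\<in>X. \<Union>y\<in>Y. N +>\<^bsub>M\<^esub> (a \<odot>\<^bsub>M\<^esub> y))"

text \<open>
  For an \<open>A\<close>-module \<open>M\<close> and a submodule \<open>N\<close>, \<open>quot_module M N\<close> is \<open>M/N\<close> as an \<open>A\<close>-module.
  If moreover \<open>JM \<subseteq> N\<close> for an ideal \<open>J\<close> of \<open>A\<close>, then \<open>quot_module_red M N\<close> is \<open>M/N\<close> as an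
  \<open>A/J\<close>-module; its scalars are the cosets of \<open>J\<close>.  The fields \<open>mult\<close> and \<open>one\<close> are only there
  because module records extend ring records; they play no role in the notion of a module.
\<close>

definition quot_module :: "('a, 'm, 'c) module_scheme \<Rightarrow> 'm set \<Rightarrow> ('a, 'm set) module" where
  "quot_module M N =
    \<lparr>carrier = a_rcosets\<^bsub>M\<^esub> N, mult = rcoset_mult M N, one = N +>\<^bsub>M\<^esub> \<one>\<^bsub>M\<^esub>, zero = N,
     add = set_add M, smult = (\<lambda>a. rcoset_smult M N {a})\<rparr>"

definition quot_module_red ::
    "('a, 'm, 'c) module_scheme \<Rightarrow> 'm set \<Rightarrow> ('a set, 'm set) module" where
  "quot_module_red M N =
    \<lparr>carrier = a_rcosets\<^bsub>M\<^esub> N, mult = rcoset_mult M N, one = N +>\<^bsub>M\<^esub> \<one>\<^bsub>M\<^esub>, zero = N,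
     add = set_add M, smult = rcoset_smult M N\<rparr>"

definition module_iso ::
    "('a, 'b) ring_scheme \<Rightarrow> ('a, 'm, 'c) module_scheme \<Rightarrow> ('a, 'n, 'd) module_scheme
      \<Rightarrow> ('m \<Rightarrow> 'n) set" where
  "module_iso A M N =
    {h. bij_betw h (carrier M) (carrier N) \<and>
        (\<forall>x\<in>carrier M. \<forall>y\<in>carrier M. h (x \<oplus>\<^bsub>M\<^esub> y) = h x \<oplus>\<^bsub>N\<^esub> h y) \<and>
        (\<forall>a\<in>carrier A. \<forall>x\<in>carrier M. h (a \<odot>\<^bsub>M\<^esub> x) = a \<odot>\<^bsub>N\<^esub> h x)}"


section \<open>Adic completeness\<close>

text \<open>The inverse limit of a tower of modules \<open>Q n\<close> with transition maps
  \<open>t n\<close> from \<open>Q (Suc n)\<close> to \<open>Q n\<close>.\<close>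

definition inverse_limit ::
    "(nat \<Rightarrow> ('a, 'm) module) \<Rightarrow> (nat \<Rightarrow> 'm \<Rightarrow> 'm) \<Rightarrow> ('a, nat \<Rightarrow> 'm) module" where
  "inverse_limit Q t =
    \<lparr>carrier = {x. (\<forall>n. x n \<in> carrier (Q n)) \<and> (\<forall>n. t n (x (Suc n)) = x n)},
     mult = (\<lambda>x y n. x n \<otimes>\<^bsub>Q n\<^esub> y n), one = (\<lambda>n. \<one>\<^bsub>Q n\<^esub>),
     zero = (\<lambda>n. \<zero>\<^bsub>Q n\<^esub>), add = (\<lambda>x y n. x n \<oplus>\<^bsub>Q n\<^esub> y n),
     smult = (\<lambda>a x n. a \<odot>\<^bsub>Q n\<^esub> x n)\<rparr>"

definition adic_filtration ::
    "('a, 'b) ring_scheme \<Rightarrow> ('a, 'm, 'c) module_scheme \<Rightarrow> 'a set \<Rightarrow> nat \<Rightarrow> 'm set" where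
  "adic_filtration A M J n = ideal_smult A M (J [^]\<^bsub>ideals_set A\<^esub> n)"

text \<open>The transition map \<open>M/J\<^sup>n\<^sup>+\<^sup>1M \<rightarrow> M/J\<^sup>nM\<close> sends a coset to the coset of \<open>J\<^sup>nM\<close> containing it.\<close>

definition adic_completion ::
    "('a, 'b) ring_scheme \<Rightarrow> ('a, 'm, 'c) module_scheme \<Rightarrow> 'a set \<Rightarrow> ('a, nat \<Rightarrow> 'm set) module"
  where
  "adic_completion A M J =
    inverse_limit (\<lambda>n. quot_module M (adic_filtration A M J n))
      (\<lambda>n X. \<Union>x\<in>X. adic_filtration A M J n +>\<^bsub>M\<^esub> x)"

definition adically_complete ::
    "('a, 'b) ring_scheme \<Rightarrow> ('a, 'm, 'c) module_scheme \<Rightarrow> 'a set \<Rightarrow> bool" where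
  "adically_complete A M J \<longleftrightarrow>
    (\<lambda>x n. adic_filtration A M J n +>\<^bsub>M\<^esub> x) \<in> module_iso A M (adic_completion A M J)"

end

theory Submission
  imports Defs "HOL-Library.Multiset_Order"
begin

text \<open>
  Let \<open>B = S[[q\<^sub>1, \<dots>, q\<^sub>k]]\<close> and let \<open>F n\<close> be the ideal of series of order at least \<open>n\<close>; the image of
  \<open>F n\<close> in \<open>M = B/I\<close> is \<open>\<aa>\<^sup>nM\<close>.  The series ring is complete for this filtration, so everything rests on
  \<open>M\<close> being separated, that is, on \<open>I\<close> being closed.  This is shown directly, without the Noetherian
  property of \<open>B\<close> or Artin-Rees: for a degree-compatible order of the monomials, the coefficients of the
  initial terms of \<open>I\<close> at a monomial form an ideal of \<open>S\<close> that grows with the monomial, so by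
  Dickson's lemma and the ascending chain condition in \<open>S\<close> finitely many elements of \<open>I\<close> account for
  all of them, and every element of the closure of \<open>I\<close> is a convergent combination of these.
  Finite generation follows by successive approximation: generators of \<open>M/\<aa>M\<close> express each element
  of \<open>M\<close> modulo \<open>\<aa>M\<close>, then modulo \<open>\<aa>\<^sup>2M\<close>, and so on, and the coefficients converge in \<open>A\<close>.
\<close>

section \<open>The ring of power series\<close>

text \<open>One approximation principle, \<open>topological_Nakayama\<close>, serves twice: with the
  preimages \<open>I + F n\<close> of \<open>\<aa>^n M\<close> it yields generators of
  \<open>M\<close>, and with the elements of order at least \<open>n\<close> in the closure of
  \<open>I\<close> it yields closedness. Its conclusion holds only up to terms of high order, so in
  the first use it becomes an equality modulo \<open>I\<close> only once \<open>I\<close> is known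
  to be closed: finite generation, too, has to wait for separatedness. All limits are taken in the
  two series rings, where they exist coefficient by coefficient; \<open>M\<close> is reached through
  representatives. Closedness is accessible because lying in the closure is tested in finitely many
  degrees at a time: such a series agrees with an element of \<open>I\<close> up to the degree of
  its initial term, hence has the initial term of an element of \<open>I\<close>, and subtracting an
  element of \<open>I\<close> does not leave the closure. The monomial order must compare degrees
  first, since a degree has only finitely many monomials to clear before the order of the remainder
  goes up.\<close>

lemma finite_multisets_size_le: "finite V \<Longrightarrow> finite {m. set_mset m \<subseteq> V \<and> size m \<le> n}"
proof -
  assume "finite V"
  have "{m. set_mset m \<subseteq> V \<and> size m \<le> n} \<subseteq> mset ` {xs. set xs \<subseteq> V \<and> length xs \<le> n}"
  proof
    fix m assume m: "m \<in> {m. set_mset m \<subseteq> V \<and> size m \<le> n}"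
    obtain xs where "mset xs = m" using ex_mset by blast
    with m show "m \<in> mset ` {xs. set xs \<subseteq> V \<and> length xs \<le> n}" by auto
  qed
  thus ?thesis using finite_lists_length_le[OF \<open>finite V\<close>] by (meson finite_imageI finite_subset)
qed

lemma finite_submultisets [simp]: "finite {n. n \<subseteq># m}"
  by (rule finite_subset[OF _ finite_multisets_size_le[of "set_mset m" "size m"]])
    (auto dest: mset_subset_eqD size_mset_mono)

lemma submultiset_diff_diff: "n \<subseteq># m \<Longrightarrow> m - (m - n) = (n :: 'a multiset)"
  by (metis add_diff_cancel_right' subset_mset.add_diff_inverse)

lemma (in abelian_monoid) finsum_Sigma:
  assumes "finite A" "\<And>x. x \<in> A \<Longrightarrow> finite (B x)"
    and "\<And>x y. x \<in> A \<Longrightarrow> y \<in> B x \<Longrightarrow> f x y \<in> carrier G"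
  shows "(\<Oplus>x\<in>A. \<Oplus>y\<in>B x. f x y) = (\<Oplus>z\<in>Sigma A B. f (fst z) (snd z))"
proof -
  have "(\<Oplus>z\<in>(\<Union>x\<in>A. Pair x ` B x). f (fst z) (snd z)) = (\<Oplus>x\<in>A. \<Oplus>z\<in>Pair x ` B x. f (fst z) (snd z))"
    by (rule add.finprod_UN_disjoint) (use assms in \<open>auto simp: pairwise_def disjnt_def\<close>)
  also have "\<dots> = (\<Oplus>x\<in>A. \<Oplus>y\<in>B x. f x y)"
  proof (rule finsum_cong')
    fix x assume x: "x \<in> A"
    show "(\<Oplus>z\<in>Pair x ` B x. f (fst z) (snd z)) = (\<Oplus>y\<in>B x. f x y)"
      by (subst add.finprod_reindex) (use assms x in \<open>auto simp: inj_on_def\<close>)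
  qed (use assms in \<open>auto intro!: finsum_closed\<close>)
  moreover have "(\<Union>x\<in>A. Pair x ` B x) = Sigma A B" by auto
  ultimately show ?thesis by simp
qed

lemma (in abelian_monoid) finsum_mem:
  assumes "N \<subseteq> carrier G" "\<zero> \<in> N" "\<And>x y. x \<in> N \<Longrightarrow> y \<in> N \<Longrightarrow> x \<oplus> y \<in> N"
    and "\<And>i. i \<in> X \<Longrightarrow> f i \<in> N"
  shows "(\<Oplus>i\<in>X. f i) \<in> N"
  using assms(4)
proof (induction X rule: infinite_finite_induct)
  case (insert i X)
  then have "f \<in> X \<rightarrow> carrier G" "f i \<in> carrier G" using assms(1) by auto
  then show ?case using insert assms(3) by simp
qed (use assms(2) in auto)

lemma (in abelian_group) minus_add_cancel:
  "x \<in> carrier G \<Longrightarrow> y \<in> carrier G \<Longrightarrow> (x \<ominus> y) \<oplus> y = x"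
  by (simp add: a_minus_def a_assoc l_neg)

section \<open>Ring structure on coefficient functions\<close>

lemma ps_carrier: "f \<in> carrier (power_series R k) \<longleftrightarrow>
    (\<forall>m. f m \<in> carrier R) \<and> (\<forall>m. \<not> set_mset m \<subseteq> {1..k} \<longrightarrow> f m = \<zero>\<^bsub>R\<^esub>)"
  by (simp add: power_series_def)

lemma ps_coeff_closed: "f \<in> carrier (power_series R k) \<Longrightarrow> f m \<in> carrier R"
  by (simp add: power_series_def)

lemma ps_add: "f \<oplus>\<^bsub>power_series R k\<^esub> g = (\<lambda>m. f m \<oplus>\<^bsub>R\<^esub> g m)"
  by (simp add: power_series_def)

lemma ps_mult: "f \<otimes>\<^bsub>power_series R k\<^esub> g = (\<lambda>m. \<Oplus>\<^bsub>R\<^esub>n\<in>{n. n \<subseteq># m}. f n \<otimes>\<^bsub>R\<^esub> g (m - n))"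
  by (simp add: power_series_def)

lemma ps_zero: "\<zero>\<^bsub>power_series R k\<^esub> = (\<lambda>m. \<zero>\<^bsub>R\<^esub>)"
  by (simp add: power_series_def)

lemma ps_one: "\<one>\<^bsub>power_series R k\<^esub> = (\<lambda>m. if m = {#} then \<one>\<^bsub>R\<^esub> else \<zero>\<^bsub>R\<^esub>)"
  by (simp add: power_series_def)

definition ps_monom :: "('a, 'b) ring_scheme \<Rightarrow> 'a \<Rightarrow> nat multiset \<Rightarrow> nat multiset \<Rightarrow> 'a" where
  "ps_monom R c p = (\<lambda>m. if m = p then c else \<zero>\<^bsub>R\<^esub>)"

context cring
begin

lemma ps_mult_closed:
  assumes f: "f \<in> carrier (power_series R k)" and g: "g \<in> carrier (power_series R k)"
  shows "f \<otimes>\<^bsub>power_series R k\<^esub> g \<in> carrier (power_series R k)"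
  unfolding ps_carrier ps_mult
proof (intro conjI allI impI)
  fix m
  show "(\<Oplus>n\<in>{n. n \<subseteq># m}. f n \<otimes> g (m - n)) \<in> carrier R"
    using f g by (auto intro!: finsum_closed simp: ps_carrier)
  assume m: "\<not> set_mset m \<subseteq> {1..k}"
  have "f n \<otimes> g (m - n) = \<zero>" if "n \<subseteq># m" for n
  proof -
    have "set_mset m = set_mset n \<union> set_mset (m - n)"
      using that by (metis set_mset_union subset_mset.add_diff_inverse)
    then show ?thesis using f g m unfolding ps_carrier by (metis Un_least l_null r_null)
  qed
  then have "(\<Oplus>n\<in>{n. n \<subseteq># m}. f n \<otimes> g (m - n)) = (\<Oplus>n\<in>{n. n \<subseteq># m}. \<zero>)"
    by (intro finsum_cong') auto
  then show "(\<Oplus>n\<in>{n. n \<subseteq># m}. f n \<otimes> g (m - n)) = \<zero>" by simp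
qed

lemma ps_mult_comm:
  assumes f: "f \<in> carrier (power_series R k)" and g: "g \<in> carrier (power_series R k)"
  shows "f \<otimes>\<^bsub>power_series R k\<^esub> g = g \<otimes>\<^bsub>power_series R k\<^esub> f"
proof
  fix m :: "nat multiset"
  let ?A = "{n. n \<subseteq># m}"
  have bij: "?A = (\<lambda>n. m - n) ` ?A"
    by (auto simp: image_iff) (metis diff_subset_eq_self submultiset_diff_diff)
  have inj: "inj_on (\<lambda>n. m - n) ?A"
    by (rule inj_onI) (metis mem_Collect_eq submultiset_diff_diff)
  have "(\<Oplus>n\<in>?A. f n \<otimes> g (m - n)) = (\<Oplus>n\<in>(\<lambda>n. m - n) ` ?A. f n \<otimes> g (m - n))"
    using bij by simp
  also have "\<dots> = (\<Oplus>n\<in>?A. f (m - n) \<otimes> g (m - (m - n)))"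
    by (rule finsum_reindex) (use f g inj in \<open>auto simp: ps_carrier\<close>)
  also have "\<dots> = (\<Oplus>n\<in>?A. g n \<otimes> f (m - n))"
    by (rule finsum_cong') (use f g in \<open>auto simp: ps_carrier m_comm submultiset_diff_diff\<close>)
  finally show "(f \<otimes>\<^bsub>power_series R k\<^esub> g) m = (g \<otimes>\<^bsub>power_series R k\<^esub> f) m"
    by (simp add: ps_mult)
qed

lemma ps_mult_assoc:
  assumes f: "f \<in> carrier (power_series R k)" and g: "g \<in> carrier (power_series R k)"
    and h: "h \<in> carrier (power_series R k)"
  shows "(f \<otimes>\<^bsub>power_series R k\<^esub> g) \<otimes>\<^bsub>power_series R k\<^esub> h =
    f \<otimes>\<^bsub>power_series R k\<^esub> (g \<otimes>\<^bsub>power_series R k\<^esub> h)"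
proof
  fix m :: "nat multiset"
  have [simp]: "\<And>m. f m \<in> carrier R" "\<And>m. g m \<in> carrier R" "\<And>m. h m \<in> carrier R"
    using f g h by (auto simp: ps_carrier)
  let ?D = "\<lambda>m :: nat multiset. {n. n \<subseteq># m}"
  \<comment> \<open>Both index sets list the factorisations of \<open>m\<close> into three
    monomials: \<open>?P\<close> by the product of the first two together with the first,
    \<open>?Q\<close> by the first two. \<open>?s\<close> translates the one into the other, and
    \<open>?t\<close> is the summand in terms of \<open>?Q\<close>.\<close>
  let ?P = "Sigma (?D m) ?D" and ?Q = "Sigma (?D m) (\<lambda>p. ?D (m - p))"
  let ?t = "\<lambda>z. f (fst z) \<otimes> (g (snd z) \<otimes> h (m - fst z - snd z))"
  let ?s = "\<lambda>z. (snd z, fst z - snd z)"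
  have inj: "inj_on ?s ?P"
    by (rule inj_onI, clarsimp) (metis subset_mset.add_diff_inverse)
  have img: "?s ` ?P = ?Q"
  proof (intro equalityI subsetI)
    fix z assume "z \<in> ?Q"
    then obtain p r where z: "z = (p, r)" "p \<subseteq># m" "r \<subseteq># m - p" by auto
    then have "p + r \<subseteq># m" by (metis add.commute subset_mset.le_diff_conv2)
    then have "(p + r, p) \<in> ?P" "z = ?s (p + r, p)" using z by auto
    then show "z \<in> ?s ` ?P" by blast
  next
    fix z assume "z \<in> ?s ` ?P"
    then obtain n p where z: "n \<subseteq># m" "p \<subseteq># n" "z = (p, n - p)" by auto
    then have "p \<subseteq># m" by (meson subset_mset.order_trans)
    moreover have "n - p \<subseteq># m - p" 
      using z(1) \<open>p \<subseteq># m\<close> by (simp add: subset_eq_diff_conv subset_mset.diff_add)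
    ultimately show "z \<in> ?Q" using z by auto
  qed
  have "((f \<otimes>\<^bsub>power_series R k\<^esub> g) \<otimes>\<^bsub>power_series R k\<^esub> h) m =
      (\<Oplus>n\<in>?D m. (\<Oplus>p\<in>?D n. f p \<otimes> g (n - p)) \<otimes> h (m - n))"
    by (simp add: ps_mult)
  also have "\<dots> = (\<Oplus>n\<in>?D m. \<Oplus>p\<in>?D n. f p \<otimes> g (n - p) \<otimes> h (m - n))"
    by (rule finsum_cong') (auto intro!: finsum_ldistr finsum_closed)
  also have "\<dots> = (\<Oplus>z\<in>?P. f (snd z) \<otimes> g (fst z - snd z) \<otimes> h (m - fst z))"
    by (rule finsum_Sigma) auto
  also have "\<dots> = (\<Oplus>z\<in>?P. ?t (?s z))"
    by (rule finsum_cong') (auto simp: m_assoc subset_mset.add_diff_inverse)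
  also have "\<dots> = (\<Oplus>z\<in>?s ` ?P. ?t z)"
    by (rule finsum_reindex[symmetric]) (use inj in auto)
  also have "\<dots> = (\<Oplus>z\<in>?Q. ?t z)"
    by (simp only: img)
  also have "\<dots> = (\<Oplus>p\<in>?D m. \<Oplus>r\<in>?D (m - p). f p \<otimes> (g r \<otimes> h (m - p - r)))"
    by (rule finsum_Sigma[symmetric]) auto
  also have "\<dots> = (\<Oplus>p\<in>?D m. f p \<otimes> (\<Oplus>r\<in>?D (m - p). g r \<otimes> h (m - p - r)))"
    by (rule finsum_cong') (auto intro!: finsum_rdistr[symmetric] finsum_closed)
  also have "\<dots> = (f \<otimes>\<^bsub>power_series R k\<^esub> (g \<otimes>\<^bsub>power_series R k\<^esub> h)) m"
    by (simp add: ps_mult)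
  finally show "((f \<otimes>\<^bsub>power_series R k\<^esub> g) \<otimes>\<^bsub>power_series R k\<^esub> h) m =
      (f \<otimes>\<^bsub>power_series R k\<^esub> (g \<otimes>\<^bsub>power_series R k\<^esub> h)) m" .
qed

lemma ps_monom_closed:
  "c \<in> carrier R \<Longrightarrow> set_mset p \<subseteq> {1..k} \<Longrightarrow> ps_monom R c p \<in> carrier (power_series R k)"
  by (auto simp: ps_carrier ps_monom_def)

lemma ps_monom_mult:
  assumes f: "f \<in> carrier (power_series R k)" and c: "c \<in> carrier R"
  shows "(ps_monom R c p \<otimes>\<^bsub>power_series R k\<^esub> f) m = (if p \<subseteq># m then c \<otimes> f (m - p) else \<zero>)"
proof -
  have "(ps_monom R c p \<otimes>\<^bsub>power_series R k\<^esub> f) m =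
      (\<Oplus>n\<in>{n. n \<subseteq># m}. if p = n then c \<otimes> f (m - n) else \<zero>)"
    unfolding ps_mult ps_monom_def
    by (rule finsum_cong') (use f c in \<open>auto simp: ps_carrier\<close>)
  also have "\<dots> = (if p \<subseteq># m then c \<otimes> f (m - p) else \<zero>)"
  proof (cases "p \<subseteq># m")
    case True
    then show ?thesis
      using f c by (simp add: finsum_singleton ps_carrier)
  next
    case False
    then have "(\<Oplus>n\<in>{n. n \<subseteq># m}. if p = n then c \<otimes> f (m - n) else \<zero>) = (\<Oplus>n\<in>{n. n \<subseteq># m}. \<zero>)"
      by (intro finsum_cong') auto
    then show ?thesis using False by simp
  qed
  finally show ?thesis .
qed

lemma ps_cring: "cring (power_series R k)"
proof (rule cringI)
  let ?P = "power_series R k"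
  show "abelian_group ?P"
  proof (rule abelian_groupI)
    fix f assume "f \<in> carrier ?P"
    then show "\<exists>g\<in>carrier ?P. g \<oplus>\<^bsub>?P\<^esub> f = \<zero>\<^bsub>?P\<^esub>"
      by (intro bexI[of _ "\<lambda>m. \<ominus> f m"]) (auto simp: ps_carrier ps_add ps_zero l_neg)
  qed (auto simp: ps_carrier ps_add ps_zero a_ac)
  show "comm_monoid ?P"
  proof (rule comm_monoidI)
    show "\<one>\<^bsub>?P\<^esub> \<otimes>\<^bsub>?P\<^esub> f = f" if "f \<in> carrier ?P" for f
    proof -
      have "\<one>\<^bsub>?P\<^esub> = ps_monom R \<one> {#}" by (simp add: ps_one ps_monom_def)
      then show ?thesis using that by (intro ext) (simp add: ps_monom_mult ps_coeff_closed)
    qed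
  qed (auto simp: ps_mult_closed ps_mult_assoc intro: ps_mult_comm, auto simp: ps_one ps_carrier)
  fix f g h assume fgh: "f \<in> carrier ?P" "g \<in> carrier ?P" "h \<in> carrier ?P"
  then have [simp]: "\<And>m. f m \<in> carrier R" "\<And>m. g m \<in> carrier R" "\<And>m. h m \<in> carrier R"
    by (auto simp: ps_carrier)
  have "(\<Oplus>n\<in>{n. n \<subseteq># m}. (f n \<oplus> g n) \<otimes> h (m - n)) =
      (\<Oplus>n\<in>{n. n \<subseteq># m}. f n \<otimes> h (m - n)) \<oplus> (\<Oplus>n\<in>{n. n \<subseteq># m}. g n \<otimes> h (m - n))" for m
    by (subst finsum_addf[symmetric]) (auto simp: l_distr)
  then show "(f \<oplus>\<^bsub>?P\<^esub> g) \<otimes>\<^bsub>?P\<^esub> h = f \<otimes>\<^bsub>?P\<^esub> h \<oplus>\<^bsub>?P\<^esub> g \<otimes>\<^bsub>?P\<^esub> h"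
    by (simp add: ps_mult ps_add)
qed

lemma ps_a_inv:
  assumes "f \<in> carrier (power_series R k)"
  shows "\<ominus>\<^bsub>power_series R k\<^esub> f = (\<lambda>m. \<ominus> f m)"
proof -
  interpret P: cring "power_series R k" by (rule ps_cring)
  show ?thesis
    using assms by (intro P.minus_equality) (auto simp: ps_carrier ps_add ps_zero l_neg)
qed

lemma ps_minus:
  assumes "f \<in> carrier (power_series R k)" "g \<in> carrier (power_series R k)"
  shows "f \<ominus>\<^bsub>power_series R k\<^esub> g = (\<lambda>m. f m \<ominus> g m)"
  by (simp add: a_minus_def ps_add ps_a_inv assms)

end

section \<open>The filtration by order\<close>

definition ps_order_ge :: "('a, 'b) ring_scheme \<Rightarrow> nat \<Rightarrow> nat \<Rightarrow> (nat multiset \<Rightarrow> 'a) set" where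
  "ps_order_ge R k n = {f \<in> carrier (power_series R k). \<forall>m. size m < n \<longrightarrow> f m = \<zero>\<^bsub>R\<^esub>}"

lemma ps_order_ge_carrier: "f \<in> ps_order_ge R k n \<Longrightarrow> f \<in> carrier (power_series R k)"
  by (simp add: ps_order_ge_def)

lemma ps_order_geI:
  "f \<in> carrier (power_series R k) \<Longrightarrow> (\<And>m. size m < n \<Longrightarrow> f m = \<zero>\<^bsub>R\<^esub>) \<Longrightarrow> f \<in> ps_order_ge R k n"
  by (simp add: ps_order_ge_def)

lemma ps_order_geD: "f \<in> ps_order_ge R k n \<Longrightarrow> size m < n \<Longrightarrow> f m = \<zero>\<^bsub>R\<^esub>"
  by (simp add: ps_order_ge_def)

lemma ps_order_ge_0 [simp]: "ps_order_ge R k 0 = carrier (power_series R k)"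
  by (simp add: ps_order_ge_def)

lemma ps_order_ge_antimono: "n \<le> n' \<Longrightarrow> ps_order_ge R k n' \<subseteq> ps_order_ge R k n"
  by (auto simp: ps_order_ge_def)

context cring
begin

text \<open>In a factorisation of a monomial of degree below \<open>a + b\<close> one factor has
  degree below its own bound, so every summand vanishes. With \<open>a\<close> or \<open>b\<close>
  equal to \<open>0\<close> this makes the steps of the filtration ideals.\<close>

lemma ps_mult_order_ge:
  assumes f: "f \<in> ps_order_ge R k a" and g: "g \<in> ps_order_ge R k b"
  shows "f \<otimes>\<^bsub>power_series R k\<^esub> g \<in> ps_order_ge R k (a + b)"
  unfolding ps_order_ge_def
proof (intro CollectI conjI allI impI)
  show "f \<otimes>\<^bsub>power_series R k\<^esub> g \<in> carrier (power_series R k)"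
    using f g by (simp add: ps_order_ge_def ps_mult_closed)
  fix m :: "nat multiset" assume m: "size m < a + b"
  have "f n \<otimes> g (m - n) = \<zero>" if "n \<subseteq># m" for n
  proof -
    have "size m = size n + size (m - n)" using that by (metis size_union subset_mset.add_diff_inverse)
    then have "size n < a \<or> size (m - n) < b" using m by linarith
    then show ?thesis using f g by (auto simp: ps_order_ge_def ps_carrier)
  qed
  then have "(\<Oplus>n\<in>{n. n \<subseteq># m}. f n \<otimes> g (m - n)) = (\<Oplus>n\<in>{n. n \<subseteq># m}. \<zero>)"
    by (intro finsum_cong') auto
  then show "(f \<otimes>\<^bsub>power_series R k\<^esub> g) m = \<zero>" by (simp add: ps_mult)
qed

lemma ps_order_ge_ideal: "ideal (ps_order_ge R k n) (power_series R k)"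
proof -
  interpret P: cring "power_series R k" by (rule ps_cring)
  show ?thesis
  proof (rule idealI)
    show "subgroup (ps_order_ge R k n) (add_monoid (power_series R k))"
      by (rule P.add.subgroupI)
        (auto simp: ps_order_ge_def ps_add ps_a_inv ps_zero ps_carrier intro!: exI[of _ "\<lambda>_. \<zero>"])
  next
    fix a x assume "a \<in> ps_order_ge R k n" "x \<in> carrier (power_series R k)"
    then show "x \<otimes>\<^bsub>power_series R k\<^esub> a \<in> ps_order_ge R k n"
      "a \<otimes>\<^bsub>power_series R k\<^esub> x \<in> ps_order_ge R k n"
      using ps_mult_order_ge[of x k 0 a n] ps_mult_order_ge[of a k n x 0] by auto
  qed (rule P.ring_axioms)
qed

lemma ps_minus_order_ge_iff:
  assumes "f \<in> carrier (power_series R k)" "g \<in> carrier (power_series R k)"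
  shows "f \<ominus>\<^bsub>power_series R k\<^esub> g \<in> ps_order_ge R k n \<longleftrightarrow> (\<forall>m. size m < n \<longrightarrow> f m = g m)"
proof -
  interpret P: cring "power_series R k" by (rule ps_cring)
  have "f \<ominus>\<^bsub>power_series R k\<^esub> g \<in> carrier (power_series R k)" using assms by simp
  moreover have "f m \<ominus> g m = \<zero> \<longleftrightarrow> f m = g m" for m
    using assms by (simp add: ps_carrier)
  ultimately show ?thesis using assms by (simp add: ps_order_ge_def ps_minus)
qed

text \<open>The coefficient at \<open>m\<close> is constant from the index
  \<open>Suc (size m + c)\<close> on, and the limit reads it off there. The subtraction
  \<open>n - c\<close> is truncated, so nothing is asked of the sequence as long as
  \<open>n \<le> c\<close>.\<close>

lemma ps_Cauchy_convergent:
  assumes f: "\<And>n. f n \<in> carrier (power_series R k)"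
    and Cauchy: "\<And>n. f (Suc n) \<ominus>\<^bsub>power_series R k\<^esub> f n \<in> ps_order_ge R k (n - c)"
  shows "\<exists>g\<in>carrier (power_series R k). \<forall>n. g \<ominus>\<^bsub>power_series R k\<^esub> f n \<in> ps_order_ge R k (n - c)"
proof -
  let ?g = "\<lambda>m. f (Suc (size m + c)) m"
  have g: "?g \<in> carrier (power_series R k)" using f by (simp add: ps_carrier)
  have step: "f (Suc n) m = f n m" if "size m + c < n" for n m
    using Cauchy[of n] that f by (simp add: ps_minus_order_ge_iff)
  have stable: "f (Suc (size m + c) + j) m = ?g m" for m j
    by (induction j) (auto simp: step)
  have "?g \<ominus>\<^bsub>power_series R k\<^esub> f n \<in> ps_order_ge R k (n - c)" for n
    unfolding ps_minus_order_ge_iff[OF g f]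
  proof (intro allI impI)
    fix m :: "nat multiset" assume "size m < n - c"
    then show "?g m = f n m" using stable[of m "n - Suc (size m + c)"] by simp
  qed
  then show ?thesis using g by blast
qed

lemma ps_eqI_order:
  assumes f: "f \<in> carrier (power_series R k)" and g: "g \<in> carrier (power_series R k)"
    and "\<And>n. f \<ominus>\<^bsub>power_series R k\<^esub> g \<in> ps_order_ge R k (n - c)"
  shows "f = g"
proof
  fix m
  show "f m = g m"
    using assms(3)[of "Suc (size m + c)"] f g by (simp add: ps_minus_order_ge_iff)
qed

end


section \<open>Linear combinations and successive approximation\<close>

text \<open>The elements of \<open>X\<close> index their own coefficients, which are taken from the
  source of \<open>h\<close>: the identity gives combinations over the ring itself, the structure
  map gives combinations of series over \<open>S\<close> with coefficients that are series over
  \<open>R\<close>.\<close>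

definition lincomb :: "('b, 'c) ring_scheme \<Rightarrow> ('a \<Rightarrow> 'b) \<Rightarrow> 'b set \<Rightarrow> ('b \<Rightarrow> 'a) \<Rightarrow> 'b" where
  "lincomb B h X a = (\<Oplus>\<^bsub>B\<^esub>x\<in>X. h (a x) \<otimes>\<^bsub>B\<^esub> x)"

context ring_hom_cring
begin

lemma lincomb_closed:
  "X \<subseteq> carrier S \<Longrightarrow> a \<in> X \<rightarrow> carrier R \<Longrightarrow> lincomb S h X a \<in> carrier S"
  unfolding lincomb_def by (rule S.finsum_closed) auto

lemma lincomb_add:
  assumes "X \<subseteq> carrier S" "a \<in> X \<rightarrow> carrier R" "b \<in> X \<rightarrow> carrier R"
  shows "lincomb S h X (\<lambda>x. a x \<oplus> b x) = lincomb S h X a \<oplus>\<^bsub>S\<^esub> lincomb S h X b"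
proof -
  have "lincomb S h X (\<lambda>x. a x \<oplus> b x) = (\<Oplus>\<^bsub>S\<^esub>x\<in>X. h (a x) \<otimes>\<^bsub>S\<^esub> x \<oplus>\<^bsub>S\<^esub> h (b x) \<otimes>\<^bsub>S\<^esub> x)"
    unfolding lincomb_def
  proof (rule S.finsum_cong')
    fix x assume "x \<in> X"
    then have "a x \<in> carrier R" "b x \<in> carrier R" "x \<in> carrier S" using assms by auto
    then show "h (a x \<oplus> b x) \<otimes>\<^bsub>S\<^esub> x = h (a x) \<otimes>\<^bsub>S\<^esub> x \<oplus>\<^bsub>S\<^esub> h (b x) \<otimes>\<^bsub>S\<^esub> x"
      by (simp add: S.l_distr)
  qed (use assms in \<open>auto simp: Pi_iff subset_iff\<close>)
  also have "\<dots> = lincomb S h X a \<oplus>\<^bsub>S\<^esub> lincomb S h X b"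
    unfolding lincomb_def by (rule S.finsum_addf) (use assms in \<open>auto simp: Pi_iff subset_iff\<close>)
  finally show ?thesis .
qed

lemma lincomb_smult:
  assumes "X \<subseteq> carrier S" "a \<in> X \<rightarrow> carrier R" "r \<in> carrier R"
  shows "lincomb S h X (\<lambda>x. r \<otimes> a x) = h r \<otimes>\<^bsub>S\<^esub> lincomb S h X a"
proof -
  have "h r \<otimes>\<^bsub>S\<^esub> lincomb S h X a = (\<Oplus>\<^bsub>S\<^esub>x\<in>X. h r \<otimes>\<^bsub>S\<^esub> (h (a x) \<otimes>\<^bsub>S\<^esub> x))"
  proof (cases "finite X")
    case True
    then show ?thesis
      unfolding lincomb_def by (intro S.finsum_rdistr) (use assms in auto)
  qed (simp add: lincomb_def assms)
  also have "\<dots> = lincomb S h X (\<lambda>x. r \<otimes> a x)"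
    unfolding lincomb_def
  proof (rule S.finsum_cong')
    fix x assume "x \<in> X"
    then have "a x \<in> carrier R" "x \<in> carrier S" using assms by auto
    then show "h r \<otimes>\<^bsub>S\<^esub> (h (a x) \<otimes>\<^bsub>S\<^esub> x) = h (r \<otimes> a x) \<otimes>\<^bsub>S\<^esub> x"
      using assms by (simp add: S.m_assoc)
  qed (use assms in \<open>auto simp: Pi_iff subset_iff\<close>)
  finally show ?thesis by simp
qed

lemma lincomb_zero: "X \<subseteq> carrier S \<Longrightarrow> lincomb S h X (\<lambda>x. \<zero>) = \<zero>\<^bsub>S\<^esub>"
proof -
  assume X: "X \<subseteq> carrier S"
  have "lincomb S h X (\<lambda>x. \<zero>) = (\<Oplus>\<^bsub>S\<^esub>x\<in>X. \<zero>\<^bsub>S\<^esub>)"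
    unfolding lincomb_def by (rule S.finsum_cong') (use X in auto)
  then show ?thesis by simp
qed

lemma lincomb_minus:
  assumes X: "X \<subseteq> carrier S" and a: "a \<in> X \<rightarrow> carrier R" and b: "b \<in> X \<rightarrow> carrier R"
  shows "lincomb S h X (\<lambda>x. a x \<ominus> b x) = lincomb S h X a \<ominus>\<^bsub>S\<^esub> lincomb S h X b"
proof -
  have d: "(\<lambda>x. a x \<ominus> b x) \<in> X \<rightarrow> carrier R" using a b by auto
  \<comment> \<open>Additivity applied to \<open>a = (a - b) + b\<close> spares a separate treatment
    of negatives.\<close>
  have "lincomb S h X a = lincomb S h X (\<lambda>x. (a x \<ominus> b x) \<oplus> b x)"
    unfolding lincomb_def
  proof (rule S.finsum_cong')
    fix x assume "x \<in> X"
    then have "a x \<in> carrier R" "b x \<in> carrier R" using a b by auto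
    then have "a x \<ominus> b x \<oplus> b x = a x" by (simp add: a_minus_def R.a_assoc R.l_neg)
    then show "h (a x) \<otimes>\<^bsub>S\<^esub> x = h (a x \<ominus> b x \<oplus> b x) \<otimes>\<^bsub>S\<^esub> x" by simp
  qed (use X a b in \<open>auto simp: Pi_iff subset_iff simp del: hom_add\<close>)
  also have "\<dots> = lincomb S h X (\<lambda>x. a x \<ominus> b x) \<oplus>\<^bsub>S\<^esub> lincomb S h X b"
    by (rule lincomb_add[OF X d b])
  finally show ?thesis
    using lincomb_closed[OF X b] lincomb_closed[OF X d]
    by (simp add: a_minus_def S.a_assoc S.r_neg)
qed

lemma lincomb_single:
  assumes "finite X" "X \<subseteq> carrier S" "y \<in> X" "r \<in> carrier R"
  shows "lincomb S h X (\<lambda>x. if x = y then r else \<zero>) = h r \<otimes>\<^bsub>S\<^esub> y"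
proof -
  have "lincomb S h X (\<lambda>x. if x = y then r else \<zero>) =
      (\<Oplus>\<^bsub>S\<^esub>x\<in>X. if y = x then h r \<otimes>\<^bsub>S\<^esub> x else \<zero>\<^bsub>S\<^esub>)"
    unfolding lincomb_def by (rule S.finsum_cong') (use assms in auto)
  also have "\<dots> = h r \<otimes>\<^bsub>S\<^esub> y"
    by (rule S.finsum_singleton) (use assms in auto)
  finally show ?thesis .
qed

text \<open>Asks for additive closure only, with a view to the preimage of a submodule over the
  coefficient ring, which is not known to be an ideal of the target.\<close>

lemma lincomb_mem:
  assumes "N \<subseteq> carrier S" "\<zero>\<^bsub>S\<^esub> \<in> N" "\<And>x y. x \<in> N \<Longrightarrow> y \<in> N \<Longrightarrow> x \<oplus>\<^bsub>S\<^esub> y \<in> N"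
    and "\<And>x. x \<in> X \<Longrightarrow> h (a x) \<otimes>\<^bsub>S\<^esub> x \<in> N"
  shows "lincomb S h X a \<in> N"
  unfolding lincomb_def by (rule S.finsum_mem) (use assms in auto)

lemma lincomb_ideal:
  assumes "ideal J S" "\<And>x. x \<in> X \<Longrightarrow> h (a x) \<otimes>\<^bsub>S\<^esub> x \<in> J"
  shows "lincomb S h X a \<in> J"
proof -
  interpret J: ideal J S by fact
  show ?thesis by (rule lincomb_mem) (use assms(2) in auto)
qed

end

text \<open>The constant \<open>c\<close> allows for a fixed loss of order in the coefficients, as for a combination of
  elements that are themselves of positive order.\<close>

lemma topological_Nakayama:
  fixes R :: "('r, 'x) ring_scheme" and S :: "('s, 'y) ring_scheme" and k :: nat
  defines "A \<equiv> power_series R k" and "B \<equiv> power_series S k"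
  assumes R: "cring R" and S: "cring S" and hom: "ring_hom_cring A B h"
    and h_order: "\<And>n f. f \<in> ps_order_ge R k n \<Longrightarrow> h f \<in> ps_order_ge S k n"
    and X: "X \<subseteq> carrier B" and N: "\<And>n. N n \<subseteq> carrier B"
    and step: "\<And>n f. f \<in> N n \<Longrightarrow>
      \<exists>a \<in> X \<rightarrow> ps_order_ge R k (n - c). f \<ominus>\<^bsub>B\<^esub> lincomb B h X a \<in> N (Suc n)"
    and f: "f \<in> N 0"
  shows "\<exists>a \<in> X \<rightarrow> carrier A. \<forall>n. \<exists>u \<in> N n.
    (f \<ominus>\<^bsub>B\<^esub> lincomb B h X a) \<ominus>\<^bsub>B\<^esub> u \<in> ps_order_ge S k (n - c)"
proof -
  interpret h: ring_hom_cring A B h by (rule hom)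
  \<comment> \<open>The invariant: the combination with coefficients \<open>a\<close> leaves a
    remainder in \<open>N n\<close>. By \<open>?Q\<close>, the next family differs from it by terms
    of order \<open>n - c\<close>, which is what makes the coefficients converge.\<close>
  let ?P = "\<lambda>n a. a \<in> X \<rightarrow> carrier A \<and> f \<ominus>\<^bsub>B\<^esub> lincomb B h X a \<in> N n"
  let ?Q = "\<lambda>n a b. \<forall>x\<in>X. b x \<ominus>\<^bsub>A\<^esub> a x \<in> ps_order_ge R k (n - c)"
  have fB: "f \<in> carrier B" using f N by auto
  have "?P 0 (\<lambda>x. \<zero>\<^bsub>A\<^esub>)"
    using f fB X by (simp add: h.lincomb_zero a_minus_def)
  moreover have "\<exists>b. ?P (Suc n) b \<and> ?Q n a b" if "?P n a" for n a
  proof -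
    obtain d where d: "d \<in> X \<rightarrow> ps_order_ge R k (n - c)"
      and fd: "(f \<ominus>\<^bsub>B\<^esub> lincomb B h X a) \<ominus>\<^bsub>B\<^esub> lincomb B h X d \<in> N (Suc n)"
      using step \<open>?P n a\<close> by blast
    have dA: "d \<in> X \<rightarrow> carrier A" using d by (auto simp: A_def ps_order_ge_def)
    have la: "lincomb B h X a \<in> carrier B" "lincomb B h X d \<in> carrier B"
      using h.lincomb_closed X \<open>?P n a\<close> dA by auto
    let ?b = "\<lambda>x. a x \<oplus>\<^bsub>A\<^esub> d x"
    have "(f \<ominus>\<^bsub>B\<^esub> lincomb B h X a) \<ominus>\<^bsub>B\<^esub> lincomb B h X d = f \<ominus>\<^bsub>B\<^esub> lincomb B h X ?b"
      using la fB \<open>?P n a\<close> dA X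
      by (simp add: h.lincomb_add a_minus_def h.S.a_assoc h.S.minus_add)
    moreover have "?b x \<ominus>\<^bsub>A\<^esub> a x = d x" if "x \<in> X" for x
    proof -
      have "a x \<in> carrier A" "d x \<in> carrier A" using that \<open>?P n a\<close> dA by auto
      then show ?thesis
        by (simp add: a_minus_def h.R.a_comm[of "a x" "d x"] h.R.a_assoc h.R.r_neg)
    qed
    moreover have "?b \<in> X \<rightarrow> carrier A" using \<open>?P n a\<close> dA by auto
    ultimately show ?thesis using fd d by (intro exI[of _ ?b]) auto
  qed
  ultimately obtain b where b: "\<And>n. ?P n (b n)" "\<And>n. ?Q n (b n) (b (Suc n))"
    using dependent_nat_choice[of ?P ?Q] by blast
  have "\<exists>g\<in>carrier A. \<forall>n. g \<ominus>\<^bsub>A\<^esub> b n x \<in> ps_order_ge R k (n - c)" if "x \<in> X" for x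
    unfolding A_def
    by (rule cring.ps_Cauchy_convergent[OF R]) (use b that in \<open>auto simp: A_def\<close>)
  then obtain g where g: "\<And>x. x \<in> X \<Longrightarrow> g x \<in> carrier A"
    "\<And>x n. x \<in> X \<Longrightarrow> g x \<ominus>\<^bsub>A\<^esub> b n x \<in> ps_order_ge R k (n - c)"
    by metis
  show ?thesis
  proof (intro bexI[of _ g] allI)
    show gA: "g \<in> X \<rightarrow> carrier A" using g by auto
    fix n
    interpret F: ideal "ps_order_ge S k (n - c)" B
      unfolding B_def by (rule cring.ps_order_ge_ideal[OF S])
    have bA: "b n \<in> X \<rightarrow> carrier A" using b by auto
    have l: "lincomb B h X g \<in> carrier B" "lincomb B h X (b n) \<in> carrier B"
      using h.lincomb_closed X gA bA by auto
    \<comment> \<open>The witness \<open>u\<close> is the remainder of the \<open>n\<close>-th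
      approximation. Replacing its coefficients by their limits changes the combination by an
      element of order \<open>n - c\<close>; since \<open>N n\<close> is an arbitrary set of series,
      this change cannot be absorbed into it and remains in the conclusion.\<close>
    have "lincomb B h X (\<lambda>x. g x \<ominus>\<^bsub>A\<^esub> b n x) \<in> ps_order_ge S k (n - c)"
      by (rule h.lincomb_ideal[OF F.is_ideal]) (use g h_order X in \<open>auto intro!: F.I_r_closed\<close>)
    then have "\<ominus>\<^bsub>B\<^esub> (lincomb B h X g \<ominus>\<^bsub>B\<^esub> lincomb B h X (b n)) \<in> ps_order_ge S k (n - c)"
      using h.lincomb_minus[OF X gA bA] by simp
    also have "\<ominus>\<^bsub>B\<^esub> (lincomb B h X g \<ominus>\<^bsub>B\<^esub> lincomb B h X (b n)) =
        (f \<ominus>\<^bsub>B\<^esub> lincomb B h X g) \<ominus>\<^bsub>B\<^esub> (f \<ominus>\<^bsub>B\<^esub> lincomb B h X (b n))"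
      using l fB by (simp add: a_minus_def h.S.minus_add h.S.a_ac h.S.r_neg1 h.S.r_neg2)
    finally show "\<exists>u\<in>N n. (f \<ominus>\<^bsub>B\<^esub> lincomb B h X g) \<ominus>\<^bsub>B\<^esub> u \<in> ps_order_ge S k (n - c)"
      using b(1)[of n] by blast
  qed
qed


section \<open>Ideals of power series are closed\<close>

lemma nat_sequence_incseq_subsequence:
  fixes s :: "nat \<Rightarrow> nat"
  shows "\<exists>\<phi> :: nat \<Rightarrow> nat. strict_mono \<phi> \<and> (\<forall>i j. i \<le> j \<longrightarrow> s (\<phi> i) \<le> s (\<phi> j))"
proof -
  obtain \<psi> :: "nat \<Rightarrow> nat" where \<psi>: "strict_mono \<psi>" "monoseq (\<lambda>n. s (\<psi> n))"
    using seq_monosub by blast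
  show ?thesis
  proof (cases "\<forall>i j. i \<le> j \<longrightarrow> s (\<psi> i) \<le> s (\<psi> j)")
    case False
    then have dec: "s (\<psi> j) \<le> s (\<psi> i)" if "i \<le> j" for i j
      using \<psi>(2) that by (auto simp: monoseq_def)
    \<comment> \<open>The values decrease along \<open>\<psi>\<close>, so they stay at their minimum
      from an index \<open>N\<close> attaining it on.\<close>
    obtain N where N: "\<And>n. s (\<psi> N) \<le> s (\<psi> n)"
      using ex_has_least_nat[of "\<lambda>_. True" 0 "\<lambda>n. s (\<psi> n)"] by auto
    have "s (\<psi> (N + n)) = s (\<psi> N)" for n
      using N dec[of N "N + n"] by (simp add: le_antisym)
    moreover have "strict_mono (\<lambda>n. \<psi> (N + n))"
      using \<psi>(1) by (simp add: strict_mono_def)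
    ultimately show ?thesis by (intro exI[of _ "\<lambda>n. \<psi> (N + n)"]) simp
  qed (use \<psi> in blast)
qed

text \<open>The sequence is thinned out for one variable after another; monotonicity in the
  variables treated before survives passing to a subsequence. Outside \<open>V\<close> all exponents
  are \<open>0\<close>.\<close>

lemma Dickson:
  fixes f :: "nat \<Rightarrow> 'a multiset"
  assumes "finite V" "\<And>n. set_mset (f n) \<subseteq> V"
  shows "\<exists>\<phi> :: nat \<Rightarrow> nat. strict_mono \<phi> \<and> (\<forall>i j. i \<le> j \<longrightarrow> f (\<phi> i) \<subseteq># f (\<phi> j))"
proof -
  have "\<exists>\<phi> :: nat \<Rightarrow> nat. strict_mono \<phi> \<and>
      (\<forall>x\<in>V. \<forall>i j. i \<le> j \<longrightarrow> count (f (\<phi> i)) x \<le> count (f (\<phi> j)) x)"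
    using assms(1)
  proof (induction V)
    case empty
    show ?case by (auto intro!: exI[of _ id] simp: strict_mono_def)
  next
    case (insert v V)
    then obtain \<phi> :: "nat \<Rightarrow> nat" where \<phi>: "strict_mono \<phi>"
      "\<And>x i j. x \<in> V \<Longrightarrow> i \<le> j \<Longrightarrow> count (f (\<phi> i)) x \<le> count (f (\<phi> j)) x" by blast
    obtain \<psi> :: "nat \<Rightarrow> nat" where \<psi>: "strict_mono \<psi>"
      "\<And>i j. i \<le> j \<Longrightarrow> count (f (\<phi> (\<psi> i))) v \<le> count (f (\<phi> (\<psi> j))) v"
      using nat_sequence_incseq_subsequence[of "\<lambda>n. count (f (\<phi> n)) v"] by blast
    show ?case
    proof (intro exI conjI ballI allI impI)
      show "strict_mono (\<lambda>n. \<phi> (\<psi> n))" using \<phi>(1) \<psi>(1) by (simp add: strict_mono_def)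
      fix x i j assume "x \<in> insert v V" "i \<le> (j :: nat)"
      then show "count (f (\<phi> (\<psi> i))) x \<le> count (f (\<phi> (\<psi> j))) x"
        using \<phi>(2)[of x "\<psi> i" "\<psi> j"] \<psi>(2)[of i j] strict_mono_mono[OF \<psi>(1)]
        by (auto dest: monoD)
    qed
  qed
  then obtain \<phi> :: "nat \<Rightarrow> nat" where \<phi>: "strict_mono \<phi>"
    "\<And>x i j. x \<in> V \<Longrightarrow> i \<le> j \<Longrightarrow> count (f (\<phi> i)) x \<le> count (f (\<phi> j)) x" by blast
  have "count (f (\<phi> i)) x \<le> count (f (\<phi> j)) x" if "i \<le> j" for i j x
  proof (cases "x \<in> V")
    case False
    then have "x \<notin># f (\<phi> i)" using assms(2) by blast
    then show ?thesis by (simp add: not_in_iff)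
  qed (use \<phi> that in blast)
  then show ?thesis using \<phi>(1) by (auto simp: subseteq_mset_def)
qed

text \<open>Dickson's lemma controls the monomials and the ascending chain condition the ideals: a
  bad sequence has a subsequence that increases for divisibility, and along it the ideals would
  increase strictly forever.\<close>

lemma (in noetherian_ring) monomial_ideals_finitely_many:
  fixes L :: "'v multiset \<Rightarrow> 'a set"
  assumes V: "finite V" and L: "\<And>m. ideal (L m) R"
    and mono: "\<And>m m'. m \<subseteq># m' \<Longrightarrow> set_mset m' \<subseteq> V \<Longrightarrow> L m \<subseteq> L m'"
  shows "\<exists>T. finite T \<and> (\<forall>m. set_mset m \<subseteq> V \<longrightarrow> (\<exists>t\<in>T. t \<subseteq># m \<and> L t = L m))"
proof (rule ccontr)
  assume neg: "\<not> ?thesis"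
  \<comment> \<open>A bad sequence: no entry is divided by an earlier one with the same ideal. The
    entries chosen so far form a finite set, which fails as a choice of \<open>T\<close>; the
    failure supplies the next entry.\<close>
  let ?P = "\<lambda>(f :: nat \<Rightarrow> 'v multiset) (n :: nat) r. set_mset r \<subseteq> V \<and>
    (\<forall>i<n. f i \<subseteq># r \<longrightarrow> L (f i) \<noteq> L r)"
  have "\<exists>f. \<forall>n. ?P f n (f n)"
  proof (rule dependent_wellorder_choice)
    fix n :: nat and f :: "nat \<Rightarrow> 'v multiset"
    assume "\<And>i. i < n \<Longrightarrow> ?P f i (f i)"
    then show "\<exists>r. ?P f n r"
      using neg[simplified, rule_format, of "f ` {..<n}"] by auto
  qed auto
  then obtain f :: "nat \<Rightarrow> 'v multiset" where f: "\<And>n. set_mset (f n) \<subseteq> V"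
    "\<And>i n. i < n \<Longrightarrow> f i \<subseteq># f n \<Longrightarrow> L (f i) \<noteq> L (f n)" by blast
  obtain \<phi> :: "nat \<Rightarrow> nat" where \<phi>: "strict_mono \<phi>"
    "\<And>i j. i \<le> j \<Longrightarrow> f (\<phi> i) \<subseteq># f (\<phi> j)"
    using Dickson[of V f, OF V f(1)] by metis
  let ?C = "range (\<lambda>i. L (f (\<phi> i)))"
  have incr: "L (f (\<phi> i)) \<subseteq> L (f (\<phi> j))" if "i \<le> j" for i j
    using mono \<phi>(2)[OF that] f(1) by blast
  \<comment> \<open>The ascending chain condition is used in the form that a nonempty chain of
    ideals contains its union.\<close>
  have "\<Union>?C \<in> ?C"
  proof (rule ideal_chain_is_trivial)
    show "subset.chain {I. ideal I R} ?C"
      unfolding subset_chain_def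
    proof (intro conjI ballI)
      fix X Y assume "X \<in> ?C" "Y \<in> ?C"
      then obtain i j where "X = L (f (\<phi> i))" "Y = L (f (\<phi> j))" by blast
      then show "X \<subseteq> Y \<or> Y \<subseteq> X" using incr[of i j] incr[of j i] nat_le_linear by blast
    qed (use L in blast)
  qed auto
  then obtain i where "\<Union>?C = L (f (\<phi> i))" by auto
  then have "L (f (\<phi> (Suc i))) \<subseteq> L (f (\<phi> i))" by auto
  then have "L (f (\<phi> i)) = L (f (\<phi> (Suc i)))" using incr[of i "Suc i"] by auto
  moreover have "\<phi> i < \<phi> (Suc i)" using \<phi>(1) by (simp add: strict_mono_def)
  ultimately show False using f(2) \<phi>(2)[of i "Suc i"] by auto
qed

text \<open>Monomials are compared by degree first and then by the library's order of multisets, which is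
  linear and compatible with products.\<close>

definition starts_at :: "('a, 'b) ring_scheme \<Rightarrow> (nat multiset \<Rightarrow> 'a) \<Rightarrow> nat multiset \<Rightarrow> bool" where
  "starts_at R f m \<longleftrightarrow> (\<forall>m'. size m' < size m \<or> size m' = size m \<and> m' < m \<longrightarrow> f m' = \<zero>\<^bsub>R\<^esub>)"

text \<open>Since \<open>starts_at\<close> does not demand a nonzero coefficient at
  \<open>m\<close>, the value \<open>0\<close> is included, and a sum whose initial terms cancel
  needs no case distinction.\<close>

definition initial_coeffs ::
    "('a, 'b) ring_scheme \<Rightarrow> (nat multiset \<Rightarrow> 'a) set \<Rightarrow> nat multiset \<Rightarrow> 'a set" where
  "initial_coeffs R J m = {f m | f. f \<in> J \<and> starts_at R f m}"

section \<open>Initial terms, and the closedness of ideals\<close>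

context cring
begin

text \<open>Multiplication by \<open>p\<close> is injective on monomials and reflects their order,
  so nothing appears below \<open>t + p\<close>, and the coefficient there is a single
  product.\<close>

lemma starts_at_monom_mult:
  assumes f: "f \<in> carrier (power_series R k)" and c: "c \<in> carrier R" and st: "starts_at R f t"
  shows "starts_at R (ps_monom R c p \<otimes>\<^bsub>power_series R k\<^esub> f) (t + p)"
    and "(ps_monom R c p \<otimes>\<^bsub>power_series R k\<^esub> f) (t + p) = c \<otimes> f t"
proof -
  show "starts_at R (ps_monom R c p \<otimes>\<^bsub>power_series R k\<^esub> f) (t + p)"
    unfolding starts_at_def
  proof (intro allI impI)
    fix m' assume m': "size m' < size (t + p) \<or> size m' = size (t + p) \<and> m' < t + p"
    show "(ps_monom R c p \<otimes>\<^bsub>power_series R k\<^esub> f) m' = \<zero>"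
    proof (cases "p \<subseteq># m'")
      case True
      then obtain r where r: "m' = r + p"
        by (metis add.commute subset_mset.add_diff_inverse)
      then have "size r < size t \<or> size r = size t \<and> r < t" using m' by auto
      then have "f r = \<zero>" using st by (auto simp: starts_at_def)
      then show ?thesis using f c r by (simp add: ps_monom_mult)
    qed (use f c in \<open>simp add: ps_monom_mult\<close>)
  qed
  show "(ps_monom R c p \<otimes>\<^bsub>power_series R k\<^esub> f) (t + p) = c \<otimes> f t"
    using f c by (simp add: ps_monom_mult)
qed

lemma initial_coeffs_ideal:
  assumes "ideal J (power_series R k)"
  shows "ideal (initial_coeffs R J m) R"
proof -
  interpret J: ideal J "power_series R k" by fact
  interpret P: cring "power_series R k" by (rule ps_cring)
  have J: "f \<in> carrier (power_series R k)" if "f \<in> J" for f using that by (rule J.Icarr)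
  have l_closed: "x \<otimes> a \<in> initial_coeffs R J m"
    if a: "a \<in> initial_coeffs R J m" and x: "x \<in> carrier R" for a x
  proof -
    obtain f where f: "f \<in> J" "starts_at R f m" "a = f m"
      using a by (auto simp: initial_coeffs_def)
    have "ps_monom R x {#} \<otimes>\<^bsub>power_series R k\<^esub> f \<in> J"
      using f x by (intro J.I_l_closed ps_monom_closed) auto
    then show ?thesis
      using starts_at_monom_mult[OF J[OF f(1)] x f(2), of "{#}"] f(3)
      by (auto simp: initial_coeffs_def intro!: exI[of _ "ps_monom R x {#} \<otimes>\<^bsub>power_series R k\<^esub> f"])
  qed
  show ?thesis
  proof (rule idealI)
    show "subgroup (initial_coeffs R J m) (add_monoid R)"
    proof (rule add.subgroupI)
      show "initial_coeffs R J m \<subseteq> carrier R"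
        using J by (auto simp: initial_coeffs_def ps_carrier)
      have "\<zero>\<^bsub>power_series R k\<^esub> \<in> J" by simp
      then show "initial_coeffs R J m \<noteq> {}"
        by (auto simp: initial_coeffs_def starts_at_def ps_zero)
    next
      fix a assume a: "a \<in> initial_coeffs R J m"
      then have "a \<in> carrier R" using J by (auto simp: initial_coeffs_def ps_carrier)
      then show "\<ominus> a \<in> initial_coeffs R J m" using l_closed[OF a, of "\<ominus> \<one>"] by (simp add: l_minus)
    next
      fix a b assume "a \<in> initial_coeffs R J m" "b \<in> initial_coeffs R J m"
      then obtain f g where fg: "f \<in> J" "starts_at R f m" "a = f m" "g \<in> J" "starts_at R g m" "b = g m"
        by (auto simp: initial_coeffs_def)
      then have "f \<oplus>\<^bsub>power_series R k\<^esub> g \<in> J" by auto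
      moreover have "starts_at R (f \<oplus>\<^bsub>power_series R k\<^esub> g) m"
        using fg by (auto simp: starts_at_def ps_add)
      ultimately show "a \<oplus> b \<in> initial_coeffs R J m"
        using fg by (auto simp: initial_coeffs_def ps_add intro!: exI[of _ "f \<oplus>\<^bsub>power_series R k\<^esub> g"])
    qed
  next
    fix a x assume a: "a \<in> initial_coeffs R J m" and x: "x \<in> carrier R"
    then have "a \<in> carrier R" using J by (auto simp: initial_coeffs_def ps_carrier)
    then show "x \<otimes> a \<in> initial_coeffs R J m" "a \<otimes> x \<in> initial_coeffs R J m"
      using l_closed[OF a x] x by (simp_all add: m_comm)
  qed (rule ring_axioms)
qed

text \<open>Multiplying by the monomial \<open>m' - m\<close> moves the start from \<open>m\<close>
  to \<open>m'\<close> and keeps the coefficient; the condition on \<open>m'\<close> ensures that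
  this monomial belongs to the ring.\<close>

lemma initial_coeffs_mono:
  assumes "ideal J (power_series R k)" and "m \<subseteq># m'" and "set_mset m' \<subseteq> {1..k}"
  shows "initial_coeffs R J m \<subseteq> initial_coeffs R J m'"
proof
  interpret J: ideal J "power_series R k" by fact
  fix a assume "a \<in> initial_coeffs R J m"
  then obtain f where f: "f \<in> J" "starts_at R f m" "a = f m"
    by (auto simp: initial_coeffs_def)
  obtain p where p: "m' = m + p" using assms(2) by (metis subset_mset.add_diff_inverse)
  let ?g = "ps_monom R \<one> p \<otimes>\<^bsub>power_series R k\<^esub> f"
  have "?g \<in> J" using f p assms(3) by (intro J.I_l_closed ps_monom_closed) auto
  moreover have "f m \<in> carrier R" using J.Icarr[OF f(1)] by (simp add: ps_carrier)
  ultimately show "a \<in> initial_coeffs R J m'"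
    using starts_at_monom_mult[OF J.Icarr[OF f(1)] one_closed f(2), of p] f(3) p
    by (auto simp: initial_coeffs_def intro!: exI[of _ ?g])
qed

text \<open>Division by a standard basis. For each of finitely many monomials \<open>t\<close>, the
  set \<open>G\<close> contains elements of \<open>J\<close> whose initial coefficients generate the
  ideal at \<open>t\<close>; combinations of them clear the terms of \<open>f\<close> degree by
  degree. As \<open>G\<close> is finite, only the coefficients have to converge, and the limit is an
  ordinary combination of elements of \<open>J\<close>, so membership in \<open>J\<close> does not
  presuppose closedness.\<close>

lemma ps_ideal_closed:
  assumes noeth: "noetherian_ring R" and J: "ideal J (power_series R k)"
    and f: "f \<in> carrier (power_series R k)"
    and closure: "\<And>n. \<exists>g\<in>J. \<forall>m. size m < n \<longrightarrow> f m = g m"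
  shows "f \<in> J"
proof -
  let ?P = "power_series R k" and ?L = "initial_coeffs R J"
  let ?cl = "{f \<in> carrier ?P. \<forall>n. \<exists>g\<in>J. \<forall>m. size m < n \<longrightarrow> f m = g m}"
  let ?F = "ps_order_ge R k" and ?lc = "lincomb ?P id"
  interpret P: cring ?P by (rule ps_cring)
  interpret J: ideal J ?P by fact
  interpret h: ring_hom_cring ?P ?P id
    by unfold_locales simp
  interpret noetherian_ring R by fact
  obtain T where T: "finite T"
    "\<And>m. set_mset m \<subseteq> {1..k} \<Longrightarrow> \<exists>t\<in>T. t \<subseteq># m \<and> ?L t = ?L m"
    using monomial_ideals_finitely_many[of "{1..k}" ?L]
      initial_coeffs_ideal[OF J] initial_coeffs_mono[OF J] by (metis finite_atLeastAtMost)
  \<comment> \<open>A monomial of degree \<open>n\<close> is treated by a divisor \<open>t\<close>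
    of degree at most \<open>c\<close>, so the quotient has degree at least \<open>n - c\<close>:
    this is the loss of order in the coefficients.\<close>
  obtain c where c: "\<And>t. t \<in> T \<Longrightarrow> size t \<le> c"
    using T(1) finite_nat_set_iff_bounded_le[of "size ` T"] by auto
  have "\<exists>C. C \<subseteq> carrier R \<and> finite C \<and> ?L t = Idl C" for t
    using finetely_gen[OF initial_coeffs_ideal[OF J]] by blast
  then obtain C where C: "\<And>t. C t \<subseteq> carrier R" "\<And>t. finite (C t)" "\<And>t. ?L t = Idl (C t)"
    by metis
  define g where "g t x = (SOME g. g \<in> J \<and> starts_at R g t \<and> g t = x)" for t x
  have g: "g t x \<in> J \<and> starts_at R (g t x) t \<and> g t x t = x" if "x \<in> C t" for t x
  proof -
    have "x \<in> ?L t" using that C(1,3) genideal_self[of "C t"] by auto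
    then have "\<exists>g. g \<in> J \<and> starts_at R g t \<and> g t = x" by (auto simp: initial_coeffs_def)
    then show ?thesis unfolding g_def by (rule someI_ex)
  qed
  define G where "G = (\<Union>t\<in>T. g t ` C t)"
  have fin: "finite G" using T(1) C(2) by (simp add: G_def)
  have GJ: "G \<subseteq> J" using g by (auto simp: G_def)
  then have Gc: "G \<subseteq> carrier ?P" using J.Icarr by auto
  have F: "ideal (?F n) ?P" for n by (rule ps_order_ge_ideal)
  have Fc: "a \<in> G \<rightarrow> carrier ?P" if "a \<in> G \<rightarrow> ?F n" for a n
    using that by (auto simp: ps_order_ge_def)
  have lcJ: "?lc G a \<in> J" if "a \<in> G \<rightarrow> carrier ?P" for a
    by (rule h.lincomb_ideal[OF J]) (use that GJ in \<open>auto intro!: J.I_l_closed\<close>)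

  have cl_minus: "f \<ominus>\<^bsub>?P\<^esub> j \<in> ?cl" if f: "f \<in> ?cl" and j: "j \<in> J" for f j
  proof -
    have fc: "f \<in> carrier ?P" and jc: "j \<in> carrier ?P" using f J.Icarr[OF j] by auto
    have "\<exists>g\<in>J. \<forall>m. size m < N \<longrightarrow> (f \<ominus>\<^bsub>?P\<^esub> j) m = g m" for N
    proof -
      obtain g where g: "g \<in> J" "\<And>m. size m < N \<Longrightarrow> f m = g m" using f by blast
      have "g \<ominus>\<^bsub>?P\<^esub> j \<in> J" using g(1) j by (simp add: a_minus_def)
      then show ?thesis
        using g(2) fc jc J.Icarr[OF g(1)]
        by (intro bexI[of _ "g \<ominus>\<^bsub>?P\<^esub> j"]) (simp_all add: ps_minus)
    qed
    then show ?thesis using fc jc by simp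
  qed

  \<comment> \<open>The values attained by such combinations form an ideal \<open>?U\<close>, so it
    suffices to attain the generators \<open>C t\<close> of \<open>?L t = ?L m\<close>.\<close>
  have initial: "\<exists>a \<in> G \<rightarrow> ?F (size m - c). starts_at R (?lc G a) m \<and> ?lc G a m = s"
    if m: "set_mset m \<subseteq> {1..k}" and s: "s \<in> ?L m" for m s
  proof -
    let ?U = "{s \<in> carrier R. \<exists>a \<in> G \<rightarrow> ?F (size m - c). starts_at R (?lc G a) m \<and> ?lc G a m = s}"
    interpret F: ideal "?F (size m - c)" ?P by (rule F)
    obtain t where t: "t \<in> T" "t \<subseteq># m" "?L t = ?L m" using T(2)[OF m] by blast
    define p where "p = m - t"
    have p: "m = t + p" using t(2) by (simp add: p_def subset_mset.add_diff_inverse)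
    have U_l: "x \<otimes> s \<in> ?U" if "s \<in> ?U" "x \<in> carrier R" for s x
    proof -
      obtain a where a: "a \<in> G \<rightarrow> ?F (size m - c)" "starts_at R (?lc G a) m" "?lc G a m = s"
        using \<open>s \<in> ?U\<close> by auto
      let ?x = "ps_monom R x {#}"
      have x: "?x \<in> carrier ?P" using that by (intro ps_monom_closed) auto
      have eq: "?lc G (\<lambda>y. ?x \<otimes>\<^bsub>?P\<^esub> a y) = ?x \<otimes>\<^bsub>?P\<^esub> ?lc G a"
        using h.lincomb_smult[OF Gc Fc[OF a(1)] x] by simp
      have "(\<lambda>y. ?x \<otimes>\<^bsub>?P\<^esub> a y) \<in> G \<rightarrow> ?F (size m - c)"
        using a(1) x by (auto intro: F.I_l_closed)
      moreover have "starts_at R (?lc G (\<lambda>y. ?x \<otimes>\<^bsub>?P\<^esub> a y)) m"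
        "?lc G (\<lambda>y. ?x \<otimes>\<^bsub>?P\<^esub> a y) m = x \<otimes> s"
        using starts_at_monom_mult[OF h.lincomb_closed[OF Gc Fc[OF a(1)]] that(2) a(2), of "{#}"]
          eq a(3) by auto
      ultimately show ?thesis using that by auto
    qed
    have "ideal ?U R"
    proof (rule idealI)
      show "subgroup ?U (add_monoid R)"
      proof (rule add.subgroupI)
        have "(\<lambda>y. \<zero>\<^bsub>?P\<^esub>) \<in> G \<rightarrow> ?F (size m - c)" by simp
        moreover have "starts_at R (?lc G (\<lambda>y. \<zero>\<^bsub>?P\<^esub>)) m" "?lc G (\<lambda>y. \<zero>\<^bsub>?P\<^esub>) m = \<zero>"
          unfolding h.lincomb_zero[OF Gc] by (simp_all add: starts_at_def ps_zero)
        ultimately show "?U \<noteq> {}" by blast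
      next
        fix s assume s: "s \<in> ?U"
        then show "\<ominus> s \<in> ?U" using U_l[OF s, of "\<ominus> \<one>"] by (simp add: l_minus)
      next
        fix s s' assume "s \<in> ?U" "s' \<in> ?U"
        then obtain a b where a: "a \<in> G \<rightarrow> ?F (size m - c)" "starts_at R (?lc G a) m" "?lc G a m = s"
          and b: "b \<in> G \<rightarrow> ?F (size m - c)" "starts_at R (?lc G b) m" "?lc G b m = s'"
          and c: "s \<in> carrier R" "s' \<in> carrier R"
          by auto
        have eq: "?lc G (\<lambda>y. a y \<oplus>\<^bsub>?P\<^esub> b y) = ?lc G a \<oplus>\<^bsub>?P\<^esub> ?lc G b"
          by (rule h.lincomb_add[OF Gc Fc[OF a(1)] Fc[OF b(1)]])
        have "(\<lambda>y. a y \<oplus>\<^bsub>?P\<^esub> b y) \<in> G \<rightarrow> ?F (size m - c)"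
          using a(1) b(1) by auto
        moreover have "starts_at R (?lc G (\<lambda>y. a y \<oplus>\<^bsub>?P\<^esub> b y)) m"
          using a(2) b(2) unfolding eq by (auto simp: starts_at_def ps_add)
        moreover have "?lc G (\<lambda>y. a y \<oplus>\<^bsub>?P\<^esub> b y) m = s \<oplus> s'"
          using a(3) b(3) unfolding eq by (simp add: ps_add)
        ultimately show "s \<oplus> s' \<in> ?U" using c by blast
      qed auto
    next
      fix s x assume s: "s \<in> ?U" and x: "x \<in> carrier R"
      then show "x \<otimes> s \<in> ?U" "s \<otimes> x \<in> ?U" using U_l[OF s x] by (simp_all add: m_comm)
    qed (rule ring_axioms)
    moreover have "C t \<subseteq> ?U"
    proof
      fix x assume x: "x \<in> C t"
      then have gG: "g t x \<in> G" using t(1) by (auto simp: G_def)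
      have xR: "x \<in> carrier R" using x C(1) by blast
      have gc: "g t x \<in> carrier ?P" using gG Gc by auto
      let ?q = "ps_monom R \<one> p"
      \<comment> \<open>A combination with one term: the basis element belonging to
        \<open>x\<close>, moved from \<open>t\<close> to \<open>m\<close> by the monomial
        \<open>p\<close>.\<close>
      let ?a = "\<lambda>y. if y = g t x then ?q else \<zero>\<^bsub>?P\<^esub>"
      have "size p \<ge> size m - c" using p c[OF t(1)] by simp
      moreover have qc: "?q \<in> carrier ?P" using m p by (intro ps_monom_closed) auto
      ultimately have "?q \<in> ?F (size m - c)"
        by (intro ps_order_geI) (auto simp: ps_monom_def)
      then have "?a \<in> G \<rightarrow> ?F (size m - c)" by simp
      moreover have "?lc G ?a = ?q \<otimes>\<^bsub>?P\<^esub> g t x"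
        using h.lincomb_single[OF fin Gc gG] qc by simp
      moreover have "starts_at R (?q \<otimes>\<^bsub>?P\<^esub> g t x) m" "(?q \<otimes>\<^bsub>?P\<^esub> g t x) m = x"
        using starts_at_monom_mult[OF gc one_closed, of t p] g[OF x] p xR by auto
      ultimately show "x \<in> ?U" using xR by (auto intro!: bexI[of _ ?a])
    qed
    ultimately have "Idl (C t) \<subseteq> ?U" by (rule genideal_minimal)
    then show ?thesis using s C(3) t(3) by auto
  qed

  have homogeneous: "\<exists>a \<in> G \<rightarrow> ?F (n - c). f \<ominus>\<^bsub>?P\<^esub> ?lc G a \<in> ?F (Suc n)"
    if "f \<in> ?cl" "f \<in> ?F n" for f n
  proof -
    let ?D = "{m. size m = n \<and> set_mset m \<subseteq> {1..k}}"
    interpret Fc: ideal "?F (n - c)" ?P by (rule F)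
    interpret Fn: ideal "?F n" ?P by (rule F)
    \<comment> \<open>\<open>Z\<close> contains the monomials of degree \<open>n\<close> at which
      \<open>f\<close> may still be nonzero. It is upward closed within that degree and is emptied
      from below: a combination that starts at the least element \<open>b\<close> may disturb later
      monomials, but these still belong to \<open>Z\<close>.\<close>
    have "Z \<subseteq> ?D \<longrightarrow> (\<forall>m\<in>?D. (\<exists>z\<in>Z. z \<le> m) \<longrightarrow> m \<in> Z) \<longrightarrow> (\<forall>f. f \<in> ?cl \<longrightarrow> f \<in> ?F n \<longrightarrow>
        (\<forall>m\<in>?D - Z. f m = \<zero>) \<longrightarrow> (\<exists>a \<in> G \<rightarrow> ?F (n - c). f \<ominus>\<^bsub>?P\<^esub> ?lc G a \<in> ?F (Suc n)))"
      if "finite Z" for Z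
      using that
    proof (induction Z rule: finite_linorder_min_induct)
      case empty
      show ?case
      proof (intro impI allI)
        fix f assume f: "f \<in> ?F n" "\<forall>m\<in>?D - {}. f m = \<zero>"
        have "f \<in> ?F (Suc n)"
        proof (rule ps_order_geI)
          fix m :: "nat multiset" assume "size m < Suc n"
          then have "size m < n \<or> m \<in> ?D \<or> \<not> set_mset m \<subseteq> {1..k}" by auto
          then show "f m = \<zero>"
            using f(2) ps_order_geD[OF f(1)] ps_order_ge_carrier[OF f(1)] unfolding ps_carrier
            by blast
        qed (rule ps_order_ge_carrier[OF f(1)])
        moreover have "f \<ominus>\<^bsub>?P\<^esub> ?lc G (\<lambda>_. \<zero>\<^bsub>?P\<^esub>) = f"
          using ps_order_ge_carrier[OF f(1)] by (simp add: h.lincomb_zero[OF Gc] a_minus_def)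
        ultimately show "\<exists>a \<in> G \<rightarrow> ?F (n - c). f \<ominus>\<^bsub>?P\<^esub> ?lc G a \<in> ?F (Suc n)"
          by (intro bexI[of _ "\<lambda>_. \<zero>\<^bsub>?P\<^esub>"]) auto
      qed
    next
      case (insert b Z)
      show ?case
      proof (intro impI allI)
        fix f assume sub: "insert b Z \<subseteq> ?D" and up: "\<forall>m\<in>?D. (\<exists>z\<in>insert b Z. z \<le> m) \<longrightarrow> m \<in> insert b Z"
          and f: "f \<in> ?cl" "f \<in> ?F n" "\<forall>m\<in>?D - insert b Z. f m = \<zero>"
        have b: "size b = n" "set_mset b \<subseteq> {1..k}" using sub by auto
        have st: "starts_at R f b"
          unfolding starts_at_def
        proof (intro allI impI)
          fix m assume m: "size m < size b \<or> size m = size b \<and> m < b"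
          show "f m = \<zero>"
          proof (cases "size m < n \<or> \<not> set_mset m \<subseteq> {1..k}")
            case False
            then have "m \<in> ?D" "m < b" using m b by auto
            moreover from \<open>m < b\<close> insert.hyps(2) have "m \<notin> insert b Z" by auto
            ultimately show ?thesis using f(3) by blast
          next
            case True
            then show ?thesis
              using ps_order_geD[OF f(2)] ps_order_ge_carrier[OF f(2)] unfolding ps_carrier by blast
          qed
        qed
        \<comment> \<open>Agreement below degree \<open>Suc n\<close> reaches \<open>b\<close>
          itself. This is why the closure of \<open>J\<close> has no initial coefficients beyond
          those of \<open>J\<close>.\<close>
        obtain g where g: "g \<in> J" "\<And>m. size m < Suc n \<Longrightarrow> f m = g m" using f(1) by blast
        have "starts_at R g b"
          using st g(2) b unfolding starts_at_def by (metis less_Suc_eq)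
        then have "f b \<in> ?L b" using g b by (auto simp: initial_coeffs_def)
        then obtain a where a: "a \<in> G \<rightarrow> ?F (n - c)" "starts_at R (?lc G a) b" "?lc G a b = f b"
          using initial[OF b(2), of "f b"] b(1) by blast
        have ac: "a \<in> G \<rightarrow> carrier ?P" and lc: "?lc G a \<in> carrier ?P"
          using Fc[OF a(1)] h.lincomb_closed[OF Gc] by auto
        have fc: "f \<in> carrier ?P" using f(1) by simp
        let ?f = "f \<ominus>\<^bsub>?P\<^esub> ?lc G a"
        have f'c: "?f \<in> carrier ?P" using fc lc by simp
        have "?lc G a \<in> ?F n"
          using lc a(2) b(1) by (intro ps_order_geI) (simp_all add: starts_at_def)
        then have "?f \<in> ?F n" using f(2) by (simp add: a_minus_def)
        moreover have "?f \<in> ?cl" by (rule cl_minus[OF f(1) lcJ[OF ac]])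
        moreover have "\<forall>m\<in>?D - Z. ?f m = \<zero>"
        proof
          fix m assume m: "m \<in> ?D - Z"
          have cf: "f m \<in> carrier R" using fc by (simp add: ps_carrier)
          \<comment> \<open>At \<open>b\<close> the combination was built to match. At any other
            monomial of degree \<open>n\<close> outside \<open>Z\<close> both sides vanish: upward
            closure of \<open>insert b Z\<close> puts it below \<open>b\<close>, where the
            combination has no terms.\<close>
          have "f m = ?lc G a m"
          proof (cases "m = b")
            case False
            then have "m \<notin> insert b Z" using m by auto
            then have "\<not> b \<le> m" using up m by blast
            then have "?lc G a m = \<zero>" using a(2) m b by (auto simp: starts_at_def)
            then show ?thesis using f(3) m False by auto
          qed (use a in simp)
          then show "?f m = \<zero>" using fc lc cf by (simp add: ps_minus)
        qed
        moreover have "Z \<subseteq> ?D" using sub by auto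
        moreover have "\<forall>m\<in>?D. (\<exists>z\<in>Z. z \<le> m) \<longrightarrow> m \<in> Z"
        proof (intro ballI impI)
          fix m assume "m \<in> ?D" "\<exists>z\<in>Z. z \<le> m"
          then have "m \<in> insert b Z" "m \<noteq> b" using up insert.hyps(2) by auto
          then show "m \<in> Z" by simp
        qed
        ultimately obtain a' where a': "a' \<in> G \<rightarrow> ?F (n - c)" "?f \<ominus>\<^bsub>?P\<^esub> ?lc G a' \<in> ?F (Suc n)"
          using insert.IH by blast
        have a'c: "a' \<in> G \<rightarrow> carrier ?P" by (rule Fc[OF a'(1)])
        have eq: "?f \<ominus>\<^bsub>?P\<^esub> ?lc G a' = f \<ominus>\<^bsub>?P\<^esub> ?lc G (\<lambda>y. a y \<oplus>\<^bsub>?P\<^esub> a' y)"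
          using lc fc h.lincomb_closed[OF Gc a'c]
          by (simp add: h.lincomb_add[OF Gc ac a'c] a_minus_def P.a_assoc P.minus_add)
        have "(\<lambda>y. a y \<oplus>\<^bsub>?P\<^esub> a' y) \<in> G \<rightarrow> ?F (n - c)"
          using a(1) a'(1) by auto
        then show "\<exists>a \<in> G \<rightarrow> ?F (n - c). f \<ominus>\<^bsub>?P\<^esub> ?lc G a \<in> ?F (Suc n)"
          by (rule bexI[rotated]) (use a'(2) eq in simp)
      qed
    qed
    moreover have "finite ?D"
      by (rule finite_subset[OF _ finite_multisets_size_le[of "{1..k}" n]]) auto
    ultimately show ?thesis using that by blast
  qed

  \<comment> \<open>Scalars and series come from the same ring here, with the identity as
    homomorphism. Intersecting with \<open>?cl\<close> keeps the remainder in the closure, so that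
    \<open>homogeneous\<close> applies to it again.\<close>
  have "\<exists>a \<in> G \<rightarrow> carrier ?P. \<forall>n. \<exists>u \<in> ?cl \<inter> ?F n.
      (f \<ominus>\<^bsub>?P\<^esub> ?lc G a) \<ominus>\<^bsub>?P\<^esub> u \<in> ?F (n - c)"
  proof (rule topological_Nakayama[where N = "\<lambda>n. ?cl \<inter> ?F n", OF cring_axioms cring_axioms h.ring_hom_cring_axioms _ Gc])
    fix n f assume fn: "f \<in> ?cl \<inter> ?F n"
    then obtain a where a: "a \<in> G \<rightarrow> ?F (n - c)" "f \<ominus>\<^bsub>?P\<^esub> ?lc G a \<in> ?F (Suc n)"
      using homogeneous by blast
    have "f \<ominus>\<^bsub>?P\<^esub> ?lc G a \<in> ?cl" using cl_minus fn lcJ[OF Fc[OF a(1)]] by blast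
    then show "\<exists>a \<in> G \<rightarrow> ?F (n - c). f \<ominus>\<^bsub>?P\<^esub> ?lc G a \<in> ?cl \<inter> ?F (Suc n)"
      using a by blast
  qed (use f closure in auto)
  then obtain a where a: "a \<in> G \<rightarrow> carrier ?P"
    "\<forall>n. \<exists>u \<in> ?cl \<inter> ?F n. (f \<ominus>\<^bsub>?P\<^esub> ?lc G a) \<ominus>\<^bsub>?P\<^esub> u \<in> ?F (n - c)" by (rule bexE)
  have lc: "?lc G a \<in> carrier ?P" using a(1) by (rule h.lincomb_closed[OF Gc])
  \<comment> \<open>The element \<open>u\<close> has order at least \<open>n\<close>, so
    \<open>f\<close> and the combination agree to order \<open>n - c\<close> for every
    \<open>n\<close>.\<close>
  have "f = ?lc G a"
  proof (rule ps_eqI_order[OF f lc])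
    fix n
    interpret Fc: ideal "?F (n - c)" ?P by (rule F)
    from spec[OF a(2), of n] obtain u where "u \<in> ?cl \<inter> ?F n"
      and u2: "(f \<ominus>\<^bsub>?P\<^esub> ?lc G a) \<ominus>\<^bsub>?P\<^esub> u \<in> ?F (n - c)" by (rule bexE)
    then have u1: "u \<in> ?F n" by simp
    have "u \<in> ?F (n - c)" using u1 ps_order_ge_antimono[of "n - c" n] by auto
    then have "((f \<ominus>\<^bsub>?P\<^esub> ?lc G a) \<ominus>\<^bsub>?P\<^esub> u) \<oplus>\<^bsub>?P\<^esub> u \<in> ?F (n - c)" using u2 by simp
    also have "((f \<ominus>\<^bsub>?P\<^esub> ?lc G a) \<ominus>\<^bsub>?P\<^esub> u) \<oplus>\<^bsub>?P\<^esub> u = f \<ominus>\<^bsub>?P\<^esub> ?lc G a"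
      using f lc ps_order_ge_carrier[OF u1] by (simp add: a_minus_def P.a_assoc P.l_neg)
    finally show "f \<ominus>\<^bsub>?P\<^esub> ?lc G a \<in> ?F (n - c)" .
  qed
  then show ?thesis using lcJ[OF a(1)] by simp
qed

end


section \<open>Modules and filtrations\<close>

lemma (in abelian_subgroup) a_rcos_eq_iff:
  assumes "x \<in> carrier G" "y \<in> carrier G"
  shows "H +> x = H +> y \<longleftrightarrow> x \<ominus> y \<in> H"
proof
  assume "H +> x = H +> y"
  then have "x \<in> H +> y" using a_rcos_self[OF assms(1)] by simp
  then show "x \<ominus> y \<in> H" using a_rcos_module[OF assms(2,1)] by (simp add: a_minus_def)
next
  assume "x \<ominus> y \<in> H"
  then have "x \<in> H +> y" using a_rcos_module[OF assms(2,1)] by (simp add: a_minus_def)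
  then show "H +> x = H +> y" using a_repr_independence'[OF _ assms(2)] by simp
qed

context module
begin

lemma submodule_abelian_subgroup: "submodule N R M \<Longrightarrow> abelian_subgroup N M"
  using abelian_subgroupI3 additive_subgroup.intro submodule.axioms(1) M.abelian_group_axioms
  by blast

lemma submodule_zero: "submodule N R M \<Longrightarrow> \<zero>\<^bsub>M\<^esub> \<in> N"
  using submodule_abelian_subgroup abelian_subgroup.axioms(1) additive_subgroup.zero_closed by blast

lemma gen_submodule_submodule:
  assumes "X \<subseteq> carrier M"
  shows "submodule (gen_submodule R M X) R M"
proof (rule submoduleI)
  show "gen_submodule R M X \<subseteq> carrier M"
    using carrier_is_submodule assms by (auto simp: gen_submodule_def)
  show "\<zero>\<^bsub>M\<^esub> \<in> gen_submodule R M X"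
    using submodule_zero by (auto simp: gen_submodule_def)
qed (auto simp: gen_submodule_def dest: submoduleE)

lemma gen_submodule_incl: "X \<subseteq> gen_submodule R M X"
  by (auto simp: gen_submodule_def)

lemma gen_submodule_minimal: "submodule N R M \<Longrightarrow> X \<subseteq> N \<Longrightarrow> gen_submodule R M X \<subseteq> N"
  by (auto simp: gen_submodule_def)

text \<open>With \<open>gen_submodule_minimal\<close>, this reduces the claim that \<open>r\<close>
  maps a generated submodule into \<open>N\<close> to the generators.\<close>

lemma submodule_smult_vimage:
  assumes N: "submodule N R M" and r: "r \<in> carrier R"
  shows "submodule {x \<in> carrier M. r \<odot>\<^bsub>M\<^esub> x \<in> N} R M"
proof (rule submoduleI)
  show "\<zero>\<^bsub>M\<^esub> \<in> {x \<in> carrier M. r \<odot>\<^bsub>M\<^esub> x \<in> N}" using submodule_zero[OF N] r by simp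
next
  fix a assume "a \<in> {x \<in> carrier M. r \<odot>\<^bsub>M\<^esub> x \<in> N}"
  then show "\<ominus>\<^bsub>M\<^esub> a \<in> {x \<in> carrier M. r \<odot>\<^bsub>M\<^esub> x \<in> N}"
    using submoduleE(3)[OF N] r by (simp add: smult_r_minus)
next
  fix a x assume "a \<in> carrier R" "x \<in> {x \<in> carrier M. r \<odot>\<^bsub>M\<^esub> x \<in> N}"
  then show "a \<odot>\<^bsub>M\<^esub> x \<in> {x \<in> carrier M. r \<odot>\<^bsub>M\<^esub> x \<in> N}"
    using submoduleE(4)[OF N, of a "r \<odot>\<^bsub>M\<^esub> x"] r by (simp add: smult_assoc1[symmetric] m_comm)
qed (use submoduleE(5)[OF N] r in \<open>auto simp: smult_r_distr\<close>)

lemma smult_diff: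
  assumes "a \<in> carrier R" "b \<in> carrier R" "x \<in> carrier M" "y \<in> carrier M"
  shows "a \<odot>\<^bsub>M\<^esub> x \<ominus>\<^bsub>M\<^esub> b \<odot>\<^bsub>M\<^esub> y = a \<odot>\<^bsub>M\<^esub> (x \<ominus>\<^bsub>M\<^esub> y) \<oplus>\<^bsub>M\<^esub> (a \<ominus> b) \<odot>\<^bsub>M\<^esub> y"
proof -
  have "a \<odot>\<^bsub>M\<^esub> (x \<ominus>\<^bsub>M\<^esub> y) \<oplus>\<^bsub>M\<^esub> (a \<ominus> b) \<odot>\<^bsub>M\<^esub> y =
      (a \<odot>\<^bsub>M\<^esub> x \<oplus>\<^bsub>M\<^esub> \<ominus>\<^bsub>M\<^esub> (a \<odot>\<^bsub>M\<^esub> y)) \<oplus>\<^bsub>M\<^esub> (a \<odot>\<^bsub>M\<^esub> y \<oplus>\<^bsub>M\<^esub> \<ominus>\<^bsub>M\<^esub> (b \<odot>\<^bsub>M\<^esub> y))"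
    using assms by (simp add: a_minus_def smult_r_distr smult_l_distr smult_r_minus smult_l_minus)
  also have "\<dots> = a \<odot>\<^bsub>M\<^esub> x \<ominus>\<^bsub>M\<^esub> b \<odot>\<^bsub>M\<^esub> y"
    using assms by (simp add: a_minus_def M.a_assoc M.r_neg1)
  finally show ?thesis by simp
qed

text \<open>Independence of representatives, for both kinds of quotient: \<open>D = {a}\<close> for
  scalars in the ring itself, and \<open>D\<close> a coset of an ideal \<open>J\<close> with
  \<open>JM \<subseteq> N\<close> for scalars in the residue ring. \<open>smult_diff\<close>
  separates the change of vector from the change of scalar.\<close>

lemma rcoset_smult_rcos:
  assumes N: "submodule N R M" and D: "D \<subseteq> carrier R" and a: "a \<in> D" and x: "x \<in> carrier M"
    and JN: "\<And>b. b \<in> D \<Longrightarrow> (b \<ominus> a) \<odot>\<^bsub>M\<^esub> x \<in> N"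
  shows "rcoset_smult M N D (N +>\<^bsub>M\<^esub> x) = N +>\<^bsub>M\<^esub> (a \<odot>\<^bsub>M\<^esub> x)"
proof -
  interpret N: abelian_subgroup N M by (rule submodule_abelian_subgroup[OF N])
  have "N +>\<^bsub>M\<^esub> (b \<odot>\<^bsub>M\<^esub> y) = N +>\<^bsub>M\<^esub> (a \<odot>\<^bsub>M\<^esub> x)" if b: "b \<in> D" and y: "y \<in> N +>\<^bsub>M\<^esub> x" for b y
  proof -
    have yc: "y \<in> carrier M" using y x by (meson N.a_elemrcos_carrier)
    have "y \<ominus>\<^bsub>M\<^esub> x \<in> N" using N.a_rcos_module[OF x yc] y by (simp add: a_minus_def)
    then have "b \<odot>\<^bsub>M\<^esub> (y \<ominus>\<^bsub>M\<^esub> x) \<in> N" using submoduleE(4)[OF N] b D by blast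
    moreover have ab: "a \<in> carrier R" "b \<in> carrier R" using a b D by auto
    ultimately have "b \<odot>\<^bsub>M\<^esub> y \<ominus>\<^bsub>M\<^esub> a \<odot>\<^bsub>M\<^esub> x \<in> N"
      unfolding smult_diff[OF ab(2,1) yc x] using JN[OF b] submoduleE(5)[OF N] by simp
    then show ?thesis
      using N.a_rcos_eq_iff ab x yc by auto
  qed
  moreover have "x \<in> N +>\<^bsub>M\<^esub> x" using x by (rule N.a_rcos_self)
  ultimately show ?thesis unfolding rcoset_smult_def using a by blast
qed

text \<open>Separatedness gives injectivity. For surjectivity, representatives of a compatible
  family of cosets form a Cauchy sequence, and its limit represents the whole family.\<close>

lemma complete_filtration_iso:
  assumes N: "\<And>n. submodule (N n) R M" and decr: "\<And>n. N (Suc n) \<subseteq> N n"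
    and separated: "\<And>x. x \<in> carrier M \<Longrightarrow> (\<And>n. x \<in> N n) \<Longrightarrow> x = \<zero>\<^bsub>M\<^esub>"
    and Cauchy: "\<And>x. (\<And>n. x n \<in> carrier M) \<Longrightarrow> (\<And>n. x (Suc n) \<ominus>\<^bsub>M\<^esub> x n \<in> N n) \<Longrightarrow>
      \<exists>y\<in>carrier M. \<forall>n. y \<ominus>\<^bsub>M\<^esub> x n \<in> N n"
  shows "(\<lambda>x n. N n +>\<^bsub>M\<^esub> x) \<in>
    module_iso R M (inverse_limit (\<lambda>n. quot_module M (N n)) (\<lambda>n X. \<Union>x\<in>X. N n +>\<^bsub>M\<^esub> x))"
    (is "?h \<in> module_iso R M ?L")
proof -
  interpret N: abelian_subgroup "N n" M for n by (rule submodule_abelian_subgroup[OF N])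
  \<comment> \<open>The transition map takes a union over all representatives; as
    \<open>N (Suc n) \<subseteq> N n\<close>, they all yield the same coset of
    \<open>N n\<close>.\<close>
  have trans: "(\<Union>y\<in>N (Suc n) +>\<^bsub>M\<^esub> x. N n +>\<^bsub>M\<^esub> y) = N n +>\<^bsub>M\<^esub> x" if x: "x \<in> carrier M" for n x
  proof -
    have "N n +>\<^bsub>M\<^esub> y = N n +>\<^bsub>M\<^esub> x" if y: "y \<in> N (Suc n) +>\<^bsub>M\<^esub> x" for y
    proof -
      have yc: "y \<in> carrier M" using y x by (meson N.a_elemrcos_carrier)
      have "y \<ominus>\<^bsub>M\<^esub> x \<in> N (Suc n)" using N.a_rcos_module[OF x yc] y by (simp add: a_minus_def)
      then show ?thesis using N.a_rcos_eq_iff[OF yc x] decr by blast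
    qed
    moreover have "x \<in> N (Suc n) +>\<^bsub>M\<^esub> x" using x by (rule N.a_rcos_self)
    ultimately show ?thesis by blast
  qed
  have carr: "X \<in> carrier ?L \<longleftrightarrow> (\<forall>n. X n \<in> a_rcosets\<^bsub>M\<^esub> N n) \<and>
      (\<forall>n. (\<Union>y\<in>X (Suc n). N n +>\<^bsub>M\<^esub> y) = X n)" for X
    by (simp add: inverse_limit_def quot_module_def)
  have "bij_betw ?h (carrier M) (carrier ?L)"
  proof (rule bij_betw_imageI)
    show "inj_on ?h (carrier M)"
    proof (rule inj_onI)
      fix x y assume xy: "x \<in> carrier M" "y \<in> carrier M" "?h x = ?h y"
      have "x \<ominus>\<^bsub>M\<^esub> y \<in> N n" for n
        using N.a_rcos_eq_iff[OF xy(1,2)] fun_cong[OF xy(3), of n] by simp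
      then have "x \<ominus>\<^bsub>M\<^esub> y = \<zero>\<^bsub>M\<^esub>" using separated xy by simp
      moreover have "x = (x \<ominus>\<^bsub>M\<^esub> y) \<oplus>\<^bsub>M\<^esub> y"
        using xy by (simp add: a_minus_def M.a_assoc M.l_neg)
      ultimately show "x = y" using xy by simp
    qed
    show "?h ` carrier M = carrier ?L"
    proof (intro equalityI subsetI)
      fix X assume "X \<in> ?h ` carrier M"
      then show "X \<in> carrier ?L"
        unfolding carr using trans by (auto simp: A_RCOSETS_def')
    next
      fix X assume X: "X \<in> carrier ?L"
      have "\<forall>n. \<exists>x. x \<in> carrier M \<and> X n = N n +>\<^bsub>M\<^esub> x"
        using X unfolding carr A_RCOSETS_def' by blast
      then obtain x where x: "\<And>n. x n \<in> carrier M" "\<And>n. X n = N n +>\<^bsub>M\<^esub> x n" by metis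
      have "x (Suc n) \<ominus>\<^bsub>M\<^esub> x n \<in> N n" for n
      proof -
        have "N n +>\<^bsub>M\<^esub> x (Suc n) = N n +>\<^bsub>M\<^esub> x n"
          using X trans[OF x(1)[of "Suc n"], of n] unfolding carr by (simp add: x(2))
        then show ?thesis using N.a_rcos_eq_iff x(1) by blast
      qed
      then obtain y where y: "y \<in> carrier M" "\<And>n. y \<ominus>\<^bsub>M\<^esub> x n \<in> N n" using Cauchy x(1) by blast
      then have "X n = N n +>\<^bsub>M\<^esub> y" for n
        using x(2) y(2) N.a_rcos_eq_iff[OF y(1) x(1)[of n]] by metis
      then have "X = ?h y" by auto
      then show "X \<in> ?h ` carrier M" using y(1) by blast
    qed
  qed
  moreover have "?h (x \<oplus>\<^bsub>M\<^esub> y) = ?h x \<oplus>\<^bsub>?L\<^esub> ?h y" if "x \<in> carrier M" "y \<in> carrier M" for x y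
    using that by (simp add: inverse_limit_def quot_module_def N.a_rcos_sum)
  moreover have "?h (a \<odot>\<^bsub>M\<^esub> x) = a \<odot>\<^bsub>?L\<^esub> ?h x" if "a \<in> carrier R" "x \<in> carrier M" for a x
    using that rcoset_smult_rcos[OF N, of "{a}" a x] submodule_zero[OF N]
    by (simp add: inverse_limit_def quot_module_def a_minus_def R.r_neg)
  ultimately show ?thesis unfolding module_iso_def by blast
qed

end

section \<open>Scalars along homomorphisms, and powers of the ideal of the variables\<close>

lemma module_along_module:
  assumes "ring_hom_cring A Q h"
  shows "module A (module_along Q h)"
proof -
  interpret ring_hom_cring A Q h by fact
  show ?thesis
  proof (rule moduleI)
    show "cring A" by (rule R.cring_axioms)
    show "abelian_group (module_along Q h)"
    proof (rule abelian_groupI)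
      fix x assume "x \<in> carrier (module_along Q h)"
      then show "\<exists>y\<in>carrier (module_along Q h).
          y \<oplus>\<^bsub>module_along Q h\<^esub> x = \<zero>\<^bsub>module_along Q h\<^esub>"
        by (intro bexI[of _ "\<ominus>\<^bsub>Q\<^esub> x"]) (simp_all add: module_along_def S.l_neg)
    qed (simp_all add: module_along_def S.a_ac)
  qed (simp_all add: module_along_def S.l_distr S.r_distr S.m_assoc)
qed

lemma (in ring_hom_cring) ps_map_ring_hom_cring:
  "ring_hom_cring (power_series R k) (power_series S k) (\<lambda>f m. h (f m))"
proof -
  interpret A: cring "power_series R k" by (rule R.ps_cring)
  interpret B: cring "power_series S k" by (rule S.ps_cring)
  have "(\<lambda>f m. h (f m)) \<in> ring_hom (power_series R k) (power_series S k)"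
  proof (rule ring_hom_memI)
    fix f g assume fg: "f \<in> carrier (power_series R k)" "g \<in> carrier (power_series R k)"
    then have [simp]: "\<And>m. f m \<in> carrier R" "\<And>m. g m \<in> carrier R" by (auto simp: ps_carrier)
    show "(\<lambda>m. h ((f \<otimes>\<^bsub>power_series R k\<^esub> g) m)) =
        (\<lambda>m. h (f m)) \<otimes>\<^bsub>power_series S k\<^esub> (\<lambda>m. h (g m))"
      by (auto simp: ps_mult intro!: S.finsum_cong')
  qed (auto simp: ps_carrier ps_add ps_one)
  then show ?thesis by unfold_locales
qed

context cring
begin

lemma ps_finsum_coeff:
  assumes "finite X" "\<And>i. i \<in> X \<Longrightarrow> f i \<in> carrier (power_series R k)"
  shows "(\<Oplus>\<^bsub>power_series R k\<^esub>i\<in>X. f i) m = (\<Oplus>i\<in>X. f i m)"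
proof -
  interpret P: cring "power_series R k" by (rule ps_cring)
  show ?thesis
    using assms
  proof (induction X rule: finite_induct)
    case (insert i X)
    then have "f \<in> X \<rightarrow> carrier (power_series R k)" "(\<lambda>i. f i m) \<in> X \<rightarrow> carrier R"
      "f i \<in> carrier (power_series R k)" "f i m \<in> carrier R"
      by (auto simp: ps_carrier)
    then show ?case using insert by (simp add: ps_add)
  qed (simp add: ps_zero)
qed

lemma ps_var_monom: "ps_var R i = ps_monom R \<one> {#i#}"
  by (simp add: ps_var_def ps_monom_def)

lemma ps_var_closed: "i \<in> {1..k} \<Longrightarrow> ps_var R i \<in> carrier (power_series R k)"
  unfolding ps_var_monom by (rule ps_monom_closed) auto

lemma ps_var_order: "i \<in> {1..k} \<Longrightarrow> ps_var R i \<in> ps_order_ge R k 1"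
  by (rule ps_order_geI[OF ps_var_closed]) (auto simp: ps_var_def)

text \<open>Each monomial of positive degree is divided by its variable of least index.\<close>

lemma ps_order_ge_Suc_decompose:
  assumes f: "f \<in> ps_order_ge R k (Suc n)"
  obtains g where "g \<in> {1..k} \<rightarrow> ps_order_ge R k n"
    "f = (\<Oplus>\<^bsub>power_series R k\<^esub>i\<in>{1..k}. ps_var R i \<otimes>\<^bsub>power_series R k\<^esub> g i)"
proof -
  let ?P = "power_series R k"
  interpret P: cring ?P by (rule ps_cring)
  define g where "g i m = (if i = Min (set_mset (add_mset i m)) then f (add_mset i m) else \<zero>)" for i m
  have fc: "\<And>m. f m \<in> carrier R" "\<And>m. \<not> set_mset m \<subseteq> {1..k} \<Longrightarrow> f m = \<zero>"
    using ps_order_ge_carrier[OF f] unfolding ps_carrier by blast+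
  have g_ord: "g i \<in> ps_order_ge R k n" for i
  proof (rule ps_order_geI)
    show "g i \<in> carrier ?P" unfolding ps_carrier g_def using fc by auto
    show "g i m = \<zero>" if "size m < n" for m
      using that ps_order_geD[OF f, of "add_mset i m"] by (auto simp: g_def)
  qed
  then have g_Pi: "g \<in> {1..k} \<rightarrow> ps_order_ge R k n" by blast
  have gc: "g i \<in> carrier ?P" for i using ps_order_ge_carrier[OF g_ord] .
  have "f = (\<Oplus>\<^bsub>?P\<^esub>i\<in>{1..k}. ps_var R i \<otimes>\<^bsub>?P\<^esub> g i)"
  proof
    fix m
    have coeff: "(ps_var R i \<otimes>\<^bsub>?P\<^esub> g i) m = (if i \<in># m \<and> i = Min (set_mset m) then f m else \<zero>)" for i
      unfolding ps_var_monom ps_monom_mult[OF gc one_closed] g_def using fc by auto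
    have "(\<Oplus>\<^bsub>?P\<^esub>i\<in>{1..k}. ps_var R i \<otimes>\<^bsub>?P\<^esub> g i) m =
        (\<Oplus>i\<in>{1..k}. if i \<in># m \<and> i = Min (set_mset m) then f m else \<zero>)"
      by (subst ps_finsum_coeff) (use gc ps_var_closed in \<open>auto simp: coeff\<close>)
    also have "\<dots> = f m"
    proof (cases "m = {#} \<or> \<not> set_mset m \<subseteq> {1..k}")
      case True
      then have "f m = \<zero>" using fc ps_order_geD[OF f, of m] by auto
      then show ?thesis by (simp cong: if_cong)
    next
      case False
      then have Min: "Min (set_mset m) \<in># m" using Min_in[of "set_mset m"] by auto
      then have "Min (set_mset m) \<in> {1..k}" using False by blast
      have "(\<Oplus>i\<in>{1..k}. if i \<in># m \<and> i = Min (set_mset m) then f m else \<zero>) =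
          (\<Oplus>i\<in>{1..k}. if Min (set_mset m) = i then f m else \<zero>)"
        by (rule finsum_cong') (use Min fc in auto)
      also have "\<dots> = f m" by (rule finsum_singleton) (use \<open>Min (set_mset m) \<in> {1..k}\<close> fc in auto)
      finally show ?thesis .
    qed
    finally show "f m = (\<Oplus>\<^bsub>?P\<^esub>i\<in>{1..k}. ps_var R i \<otimes>\<^bsub>?P\<^esub> g i) m" by simp
  qed
  then show thesis by (rule that[OF g_Pi])
qed

lemma var_ideal_ideal: "ideal (var_ideal R k) (power_series R k)"
proof -
  interpret P: cring "power_series R k" by (rule ps_cring)
  show ?thesis unfolding var_ideal_def
    by (rule P.genideal_ideal) (use ps_var_closed in auto)
qed

lemma ps_var_in_var_ideal: "i \<in> {1..k} \<Longrightarrow> ps_var R i \<in> var_ideal R k"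
proof -
  interpret P: cring "power_series R k" by (rule ps_cring)
  assume "i \<in> {1..k}"
  then show ?thesis unfolding var_ideal_def
    using P.genideal_self[of "ps_var R ` {1..k}"] ps_var_closed by blast
qed

text \<open>This gives the upper bound for \<open>\<aa>^n M\<close>; the lower bound is found in the
  module itself by means of \<open>ps_order_ge_Suc_decompose\<close>.\<close>

lemma var_ideal_pow:
  fixes n :: nat
  shows
  "ideal (var_ideal R k [^]\<^bsub>ideals_set (power_series R k)\<^esub> n) (power_series R k)"
    and "var_ideal R k [^]\<^bsub>ideals_set (power_series R k)\<^esub> n \<subseteq> ps_order_ge R k n"
proof -
  let ?P = "power_series R k"
  interpret P: cring ?P by (rule ps_cring)
  interpret IS: comm_monoid "ideals_set ?P" by (rule P.ideals_set_is_comm_monoid)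
  have carr: "J \<in> carrier (ideals_set ?P) \<longleftrightarrow> ideal J ?P" for J by (simp add: ideals_set_def)
  show "ideal (var_ideal R k [^]\<^bsub>ideals_set ?P\<^esub> n) ?P"
    using IS.nat_pow_closed[of "var_ideal R k" n] var_ideal_ideal by (simp add: carr)
  have 1: "var_ideal R k \<subseteq> ps_order_ge R k 1"
    unfolding var_ideal_def
    by (rule P.genideal_minimal[OF ps_order_ge_ideal]) (use ps_var_order in blast)
  show "var_ideal R k [^]\<^bsub>ideals_set ?P\<^esub> n \<subseteq> ps_order_ge R k n"
  proof (induction n)
    case 0
    then show ?case by (simp add: ideals_set_def)
  next
    case (Suc n)
    interpret F: ideal "ps_order_ge R k (Suc n)" ?P by (rule ps_order_ge_ideal)
    show ?case
    proof
      fix a assume "a \<in> var_ideal R k [^]\<^bsub>ideals_set ?P\<^esub> Suc n"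
      then have "a \<in> ideal_prod ?P (var_ideal R k [^]\<^bsub>ideals_set ?P\<^esub> n) (var_ideal R k)"
        by (simp add: ideals_set_def)
      then show "a \<in> ps_order_ge R k (Suc n)"
      proof (induction a rule: ideal_prod.induct)
        case (prod i j)
        then show ?case using ps_mult_order_ge[of i k n j 1] Suc 1 by auto
      qed (rule F.a_closed)
    qed
  qed
qed

end


section \<open>The quotient as a module over the power series over \<open>R\<close>\<close>

lemma (in algebra) structure_map_hom: "ring_hom_cring R M (\<lambda>r. r \<odot>\<^bsub>M\<^esub> \<one>\<^bsub>M\<^esub>)"
proof -
  have "(\<lambda>r. r \<odot>\<^bsub>M\<^esub> \<one>\<^bsub>M\<^esub>) \<in> ring_hom R M"
    by (rule ring_hom_memI) (simp_all add: smult_assoc1 smult_assoc2 smult_l_distr)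
  then show ?thesis by unfold_locales
qed

locale ps_quotient = algebra R S
  for R :: "('r, 'x) ring_scheme" and S :: "('r, 's, 'y) module_scheme" +
  fixes k :: nat and I :: "(nat multiset \<Rightarrow> 's) set"
  assumes I_ideal: "ideal I (power_series S k)"
begin

abbreviation "A \<equiv> power_series R k"
abbreviation "B \<equiv> power_series S k"
abbreviation "\<phi> \<equiv> ps_structure_map S"
abbreviation "\<pi> f \<equiv> I +>\<^bsub>B\<^esub> f"
abbreviation "M \<equiv> module_along (B Quot I) (\<lambda>f. \<pi> (\<phi> f))"
abbreviation "\<aa> \<equiv> var_ideal R k"
abbreviation "F n \<equiv> ps_order_ge S k n"

sublocale A: cring A by (rule cring.ps_cring[OF R_cring])

sublocale B: cring B by (rule cring.ps_cring[OF M_cring])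

sublocale I: ideal I B by (rule I_ideal)

sublocale phi: ring_hom_cring A B \<phi>
  using ring_hom_cring.ps_map_ring_hom_cring[OF structure_map_hom]
  unfolding ps_structure_map_def[abs_def] .

sublocale pi: ring_hom_cring B "B Quot I" "\<lambda>f. \<pi> f"
  by (rule I.rcos_ring_hom_cring[OF B.cring_axioms])

sublocale MM: module A M
proof (rule module_along_module)
  show "ring_hom_cring A (B Quot I) (\<lambda>f. \<pi> (\<phi> f))"
    by unfold_locales (auto intro!: ring_hom_memI)
qed

lemma phi_order: "f \<in> ps_order_ge R k n \<Longrightarrow> \<phi> f \<in> F n"
proof (rule ps_order_geI)
  assume f: "f \<in> ps_order_ge R k n"
  show "\<phi> f \<in> carrier B" by (rule phi.hom_closed[OF ps_order_ge_carrier[OF f]])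
  show "\<phi> f m = \<zero>\<^bsub>S\<^esub>" if "size m < n" for m
    using ps_order_geD[OF f that] by (simp add: ps_structure_map_def)
qed

lemma phi_var: "\<phi> (ps_var R i) = ps_var S i"
  by (auto simp: ps_structure_map_def ps_var_def)

lemma carrier_M: "carrier M = \<pi> ` carrier B"
  unfolding module_along_def FactRing_def A_RCOSETS_def'
  by (simp add: UNION_singleton_eq_range)

lemma pi_M: "f \<in> carrier B \<Longrightarrow> \<pi> f \<in> carrier M"
  by (auto simp: carrier_M)

lemma add_M: "f \<in> carrier B \<Longrightarrow> g \<in> carrier B \<Longrightarrow> \<pi> f \<oplus>\<^bsub>M\<^esub> \<pi> g = \<pi> (f \<oplus>\<^bsub>B\<^esub> g)"
  by (simp add: module_along_def)

lemma zero_M: "\<zero>\<^bsub>M\<^esub> = \<pi> \<zero>\<^bsub>B\<^esub>"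
  by (simp add: module_along_def)

lemma smult_M: "a \<in> carrier A \<Longrightarrow> f \<in> carrier B \<Longrightarrow> a \<odot>\<^bsub>M\<^esub> \<pi> f = \<pi> (\<phi> a \<otimes>\<^bsub>B\<^esub> f)"
  by (simp add: module_along_def)

text \<open>These rules push \<open>\<pi>\<close> inside sums and products, whereas computations in
  \<open>M\<close> are from here on pulled back to \<open>B\<close>, in the opposite
  direction.\<close>

lemmas [simp del] = pi.hom_add pi.hom_mult pi.hom_a_inv pi.hom_zero pi.hom_finsum

lemma uminus_M: "f \<in> carrier B \<Longrightarrow> \<ominus>\<^bsub>M\<^esub> \<pi> f = \<pi> (\<ominus>\<^bsub>B\<^esub> f)"
  by (rule MM.minus_equality) (simp_all add: pi_M add_M zero_M B.l_neg)

lemma minus_M: "f \<in> carrier B \<Longrightarrow> g \<in> carrier B \<Longrightarrow> \<pi> f \<ominus>\<^bsub>M\<^esub> \<pi> g = \<pi> (f \<ominus>\<^bsub>B\<^esub> g)"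
  unfolding a_minus_def by (simp only: uminus_M add_M B.a_inv_closed)

lemma F_ideal: "ideal (F n) B"
  by (rule cring.ps_order_ge_ideal[OF M_cring])

text \<open>The preimage in \<open>B\<close> of \<open>\<aa>^n M\<close>. Approximation takes place
  here rather than in \<open>M\<close>, because convergence is a statement about series.\<close>

definition N :: "nat \<Rightarrow> (nat multiset \<Rightarrow> 's) set" where
  "N n = I <+>\<^bsub>B\<^esub> F n"

lemma N_ideal: "ideal (N n) B"
  unfolding N_def by (rule B.add_ideals[OF I_ideal F_ideal])

lemma N_carrier: "f \<in> N n \<Longrightarrow> f \<in> carrier B"
  using ideal.Icarr[OF N_ideal] .

lemma pi_eq_iff: "f \<in> carrier B \<Longrightarrow> g \<in> carrier B \<Longrightarrow> \<pi> f = \<pi> g \<longleftrightarrow> f \<ominus>\<^bsub>B\<^esub> g \<in> I"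
  by (rule I.a_rcos_eq_iff)

lemma I_subset_N: "I \<subseteq> N n"
proof
  fix i assume "i \<in> I"
  moreover have "\<zero>\<^bsub>B\<^esub> \<in> F n"
    using additive_subgroup.zero_closed[OF ideal.axioms(1)[OF F_ideal]] .
  moreover have "i = i \<oplus>\<^bsub>B\<^esub> \<zero>\<^bsub>B\<^esub>" using I.Icarr[OF \<open>i \<in> I\<close>] by simp
  ultimately show "i \<in> N n" unfolding N_def set_add_def' by blast
qed

lemma F_subset_N: "F n \<subseteq> N n"
proof
  fix f assume "f \<in> F n"
  moreover have "f = \<zero>\<^bsub>B\<^esub> \<oplus>\<^bsub>B\<^esub> f" using ps_order_ge_carrier[OF \<open>f \<in> F n\<close>] by simp
  ultimately show "f \<in> N n" unfolding N_def set_add_def' using I.zero_closed by blast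
qed

lemma NE:
  assumes "f \<in> N n"
  obtains i g where "i \<in> I" "g \<in> F n" "f = i \<oplus>\<^bsub>B\<^esub> g"
  using assms unfolding N_def set_add_def' by blast

lemma pi_N_iff:
  assumes f: "f \<in> carrier B"
  shows "\<pi> f \<in> (\<lambda>f. \<pi> f) ` F n \<longleftrightarrow> f \<in> N n"
proof
  assume "\<pi> f \<in> (\<lambda>f. \<pi> f) ` F n"
  then obtain g where g: "g \<in> F n" "\<pi> f = \<pi> g" by auto
  have gc: "g \<in> carrier B" by (rule ps_order_ge_carrier[OF g(1)])
  have "f \<ominus>\<^bsub>B\<^esub> g \<in> I" using pi_eq_iff[OF f gc] g(2) by simp
  then have "(f \<ominus>\<^bsub>B\<^esub> g) \<oplus>\<^bsub>B\<^esub> g \<in> N n" using g(1) unfolding N_def set_add_def' by blast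
  then show "f \<in> N n" by (simp add: B.minus_add_cancel f gc)
next
  assume "f \<in> N n"
  then obtain i g where ig: "i \<in> I" "g \<in> F n" "f = i \<oplus>\<^bsub>B\<^esub> g" by (rule NE)
  have gc: "g \<in> carrier B" by (rule ps_order_ge_carrier[OF ig(2)])
  have "f \<ominus>\<^bsub>B\<^esub> g = i"
    using ig I.Icarr[OF ig(1)] gc by (simp add: a_minus_def B.a_assoc B.r_neg)
  then have "\<pi> f = \<pi> g" using pi_eq_iff[OF f gc] ig(1) by simp
  then show "\<pi> f \<in> (\<lambda>f. \<pi> f) ` F n" using ig(2) by blast
qed

section \<open>The adic filtration of the quotient and its completeness\<close>

lemma pi_F_submodule: "submodule ((\<lambda>f. \<pi> f) ` F n) A M"
proof -
  interpret F: ideal "F n" B by (rule F_ideal)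
  have fc: "f \<in> carrier B" if "f \<in> F n" for f by (rule F.Icarr[OF that])
  have smult: "a \<odot>\<^bsub>M\<^esub> x \<in> (\<lambda>f. \<pi> f) ` F n"
    if a: "a \<in> carrier A" and x: "x \<in> (\<lambda>f. \<pi> f) ` F n" for a x
  proof -
    obtain f where f: "f \<in> F n" "x = \<pi> f" using x by auto
    then have "\<phi> a \<otimes>\<^bsub>B\<^esub> f \<in> F n" using a by (intro F.I_l_closed) auto
    then show ?thesis using f a fc by (simp add: smult_M)
  qed
  show ?thesis
  proof (rule MM.submoduleI)
    fix x assume x: "x \<in> (\<lambda>f. \<pi> f) ` F n"
    then have "x \<in> carrier M" using fc pi_M by auto
    then have "\<ominus>\<^bsub>M\<^esub> x = (\<ominus>\<^bsub>A\<^esub> \<one>\<^bsub>A\<^esub>) \<odot>\<^bsub>M\<^esub> x" by (simp add: MM.smult_l_minus)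
    then show "\<ominus>\<^bsub>M\<^esub> x \<in> (\<lambda>f. \<pi> f) ` F n" using smult[OF _ x] by simp
  next
    fix x y assume "x \<in> (\<lambda>f. \<pi> f) ` F n" "y \<in> (\<lambda>f. \<pi> f) ` F n"
    then obtain f g where "f \<in> F n" "g \<in> F n" "x = \<pi> f" "y = \<pi> g" by auto
    then show "x \<oplus>\<^bsub>M\<^esub> y \<in> (\<lambda>f. \<pi> f) ` F n"
      using add_M[OF fc fc] F.a_closed by (metis imageI)
  qed (use fc pi_M smult F.zero_closed zero_M in auto)
qed

text \<open>One inclusion holds because \<open>\<phi>\<close> maps \<open>\<aa>^n\<close> into the
  ideal \<open>F n\<close>. The other is by induction: a series of order at least
  \<open>n + 1\<close> is a sum of variables times series of order at least \<open>n\<close>, and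
  each variable carries \<open>\<aa>^n M\<close> into the next step, since \<open>\<phi>\<close>
  maps variables to variables.\<close>

lemma adic_filtration_eq: "adic_filtration A M \<aa> n = (\<lambda>f. \<pi> f) ` F n"
proof
  let ?G = "\<lambda>n::nat. {a \<odot>\<^bsub>M\<^esub> x | a x. a \<in> \<aa> [^]\<^bsub>ideals_set A\<^esub> n \<and> x \<in> carrier M}"
  note pow = cring.var_ideal_pow[OF R_cring, of k]
  have G: "?G n \<subseteq> carrier M" for n
    using ideal.Icarr[OF pow(1)[of n]] by auto
  show "adic_filtration A M \<aa> n \<subseteq> (\<lambda>f. \<pi> f) ` F n"
    unfolding adic_filtration_def ideal_smult_def
  proof (rule MM.gen_submodule_minimal[OF pi_F_submodule], rule subsetI)
    fix y assume "y \<in> ?G n"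
    then obtain a f where y: "a \<in> \<aa> [^]\<^bsub>ideals_set A\<^esub> n" "f \<in> carrier B" "y = a \<odot>\<^bsub>M\<^esub> \<pi> f"
      unfolding carrier_M by auto
    have "\<phi> a \<in> F n" using pow(2) y(1) phi_order by blast
    then have "\<phi> a \<otimes>\<^bsub>B\<^esub> f \<in> F n" using y(2) by (intro ideal.I_r_closed[OF F_ideal])
    moreover have "y = \<pi> (\<phi> a \<otimes>\<^bsub>B\<^esub> f)" using y ideal.Icarr[OF pow(1)] by (simp add: smult_M)
    ultimately show "y \<in> (\<lambda>f. \<pi> f) ` F n" by blast
  qed
  show "(\<lambda>f. \<pi> f) ` F n \<subseteq> adic_filtration A M \<aa> n"
  proof (induction n)
    case 0
    show ?case
    proof
      fix y assume "y \<in> (\<lambda>f. \<pi> f) ` F 0"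
      then have y: "y \<in> carrier M" by (simp add: carrier_M)
      moreover have "\<one>\<^bsub>A\<^esub> \<in> \<aa> [^]\<^bsub>ideals_set A\<^esub> (0::nat)" by (simp add: ideals_set_def)
      ultimately have "\<one>\<^bsub>A\<^esub> \<odot>\<^bsub>M\<^esub> y \<in> ?G 0" by blast
      then show "y \<in> adic_filtration A M \<aa> 0"
        unfolding adic_filtration_def ideal_smult_def
        using MM.gen_submodule_incl[of "?G 0"] y by auto
    qed
  next
    case (Suc n)
    let ?N = "adic_filtration A M \<aa>"
    have sub: "submodule (?N n) A M" for n
      unfolding adic_filtration_def ideal_smult_def by (rule MM.gen_submodule_submodule[OF G])
    show ?case
    proof
      fix y assume "y \<in> (\<lambda>f. \<pi> f) ` F (Suc n)"
      then obtain f where f: "f \<in> F (Suc n)" "y = \<pi> f" by auto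
      obtain g where g: "g \<in> {1..k} \<rightarrow> F n"
        "f = (\<Oplus>\<^bsub>B\<^esub>i\<in>{1..k}. ps_var S i \<otimes>\<^bsub>B\<^esub> g i)"
        using cring.ps_order_ge_Suc_decompose[OF M_cring f(1)] by blast
      have step: "\<pi> (ps_var S i \<otimes>\<^bsub>B\<^esub> g i) \<in> ?N (Suc n)" if i: "i \<in> {1..k}" for i
      proof -
        have q: "ps_var R i \<in> carrier A" by (rule cring.ps_var_closed[OF R_cring i])
        have gi: "g i \<in> F n" "g i \<in> carrier B" using g(1) i ps_order_ge_carrier by blast+
        have "?N n \<subseteq> {x \<in> carrier M. ps_var R i \<odot>\<^bsub>M\<^esub> x \<in> ?N (Suc n)}"
          unfolding adic_filtration_def[of _ _ _ n] ideal_smult_def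
        proof (rule MM.gen_submodule_minimal[OF MM.submodule_smult_vimage[OF sub q]], rule subsetI)
          fix z assume z: "z \<in> ?G n"
          then obtain a x where ax: "a \<in> \<aa> [^]\<^bsub>ideals_set A\<^esub> n" "x \<in> carrier M" "z = a \<odot>\<^bsub>M\<^esub> x"
            by auto
          have ac: "a \<in> carrier A" using ideal.Icarr[OF pow(1) ax(1)] .
          have "a \<otimes>\<^bsub>A\<^esub> ps_var R i \<in> \<aa> [^]\<^bsub>ideals_set A\<^esub> Suc n"
            using ideal_prod.prod[OF ax(1) cring.ps_var_in_var_ideal[OF R_cring i], of A]
            by (simp add: ideals_set_def)
          moreover have "ps_var R i \<odot>\<^bsub>M\<^esub> z = (a \<otimes>\<^bsub>A\<^esub> ps_var R i) \<odot>\<^bsub>M\<^esub> x"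
            using ax ac q by (simp add: A.m_comm flip: MM.smult_assoc1)
          ultimately have "ps_var R i \<odot>\<^bsub>M\<^esub> z \<in> ?G (Suc n)" using ax(2) by blast
          then have "ps_var R i \<odot>\<^bsub>M\<^esub> z \<in> ?N (Suc n)"
            unfolding adic_filtration_def ideal_smult_def
            using MM.gen_submodule_incl[of "?G (Suc n)"] by blast
          then show "z \<in> {x \<in> carrier M. ps_var R i \<odot>\<^bsub>M\<^esub> x \<in> ?N (Suc n)}"
            using z G by blast
        qed
        then have "ps_var R i \<odot>\<^bsub>M\<^esub> \<pi> (g i) \<in> ?N (Suc n)" using Suc gi(1) by blast
        then show ?thesis using smult_M[OF q gi(2)] by (simp add: phi_var)
      qed
      \<comment> \<open>The sum stays in \<open>B\<close>: membership is shown for the preimage of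
        the submodule, which is closed under addition.\<close>
      have "f \<in> {f \<in> carrier B. \<pi> f \<in> ?N (Suc n)}"
        unfolding g(2)
      proof (rule B.finsum_mem)
        show "\<zero>\<^bsub>B\<^esub> \<in> {f \<in> carrier B. \<pi> f \<in> ?N (Suc n)}"
          using MM.submodule_zero[OF sub] zero_M by simp
        show "f \<oplus>\<^bsub>B\<^esub> h \<in> {f \<in> carrier B. \<pi> f \<in> ?N (Suc n)}"
          if "f \<in> {f \<in> carrier B. \<pi> f \<in> ?N (Suc n)}" "h \<in> {f \<in> carrier B. \<pi> f \<in> ?N (Suc n)}" for f h
          using that MM.submoduleE(5)[OF sub[of "Suc n"], of "\<pi> f" "\<pi> h"] by (simp add: add_M)
        show "ps_var S i \<otimes>\<^bsub>B\<^esub> g i \<in> {f \<in> carrier B. \<pi> f \<in> ?N (Suc n)}" if i: "i \<in> {1..k}" for i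
        proof -
          have "ps_var S i \<in> carrier B" by (rule cring.ps_var_closed[OF M_cring i])
          moreover have "g i \<in> carrier B" using g(1) i ps_order_ge_carrier by blast
          ultimately show ?thesis using step[OF i] by simp
        qed
      qed auto
      then show "y \<in> ?N (Suc n)" using f(2) by simp
    qed
  qed
qed

lemma ideal_smult_eq: "ideal_smult A M \<aa> = (\<lambda>f. \<pi> f) ` F 1"
proof -
  interpret IS: comm_monoid "ideals_set A" by (rule A.ideals_set_is_comm_monoid)
  have "\<aa> [^]\<^bsub>ideals_set A\<^esub> (1::nat) = \<aa>"
    by (rule IS.nat_pow_eone) (use cring.var_ideal_ideal[OF R_cring] in \<open>simp add: ideals_set_def\<close>)
  then show ?thesis using adic_filtration_eq[of 1] by (simp add: adic_filtration_def)
qed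

text \<open>An element of \<open>I + F n\<close> agrees with an element of \<open>I\<close> in all
  degrees below \<open>n\<close>, so this is the closedness of \<open>I\<close>.\<close>

lemma N_separated:
  assumes "noetherian_ring S" and f: "f \<in> carrier B" "\<And>n. f \<in> N n"
  shows "f \<in> I"
proof (rule cring.ps_ideal_closed[OF M_cring assms(1) I_ideal f(1)])
  fix n
  obtain i g where ig: "i \<in> I" "g \<in> F n" "f = i \<oplus>\<^bsub>B\<^esub> g" using f(2) by (rule NE)
  have "f m = i m" if "size m < n" for m
    using ig(3) ps_order_geD[OF ig(2) that] I.Icarr[OF ig(1)] by (simp add: ps_add ps_carrier)
  then show "\<exists>g\<in>I. \<forall>m. size m < n \<longrightarrow> f m = g m" using ig(1) by blast
qed

lemma adically_complete:
  assumes "noetherian_ring S"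
  shows "adically_complete A M \<aa>"
  unfolding adically_complete_def adic_completion_def adic_filtration_eq
proof (rule MM.complete_filtration_iso[OF pi_F_submodule])
  show "(\<lambda>f. \<pi> f) ` F (Suc n) \<subseteq> (\<lambda>f. \<pi> f) ` F n" for n
    using ps_order_ge_antimono[of n "Suc n" S k] by auto
next
  fix x assume "x \<in> carrier M" and x: "\<And>n. x \<in> (\<lambda>f. \<pi> f) ` F n"
  then obtain f where f: "f \<in> carrier B" "x = \<pi> f" by (auto simp: carrier_M)
  have "f \<in> N n" for n using pi_N_iff[OF f(1)] x f(2) by blast
  then have "f \<in> I" using N_separated[OF assms f(1)] by blast
  then show "x = \<zero>\<^bsub>M\<^esub>"
    unfolding f(2) zero_M using pi_eq_iff[OF f(1), of "\<zero>\<^bsub>B\<^esub>"] f(1) by (simp add: a_minus_def)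
next
  fix x assume x: "\<And>n. x n \<in> carrier M" "\<And>n. x (Suc n) \<ominus>\<^bsub>M\<^esub> x n \<in> (\<lambda>f. \<pi> f) ` F n"
  have "\<exists>f. \<forall>n. (f n \<in> carrier B \<and> \<pi> (f n) = x n) \<and> f (Suc n) \<ominus>\<^bsub>B\<^esub> f n \<in> F n"
  proof (rule dependent_nat_choice)
    show "\<exists>f. f \<in> carrier B \<and> \<pi> f = x 0" using x(1)[of 0] by (auto simp: carrier_M)
  next
    fix f n assume f: "f \<in> carrier B \<and> \<pi> f = x n"
    \<comment> \<open>An arbitrary lift \<open>f'\<close> is going to be replaced by
      \<open>g + f\<close>, where \<open>g\<close> in \<open>F n\<close> represents
      \<open>f' - f\<close> modulo \<open>I\<close>. The lifts then form a Cauchy sequence of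
      series, and not just one modulo \<open>I\<close>.\<close>
    obtain f' where f': "f' \<in> carrier B" "\<pi> f' = x (Suc n)"
      using x(1)[of "Suc n"] by (auto simp: carrier_M)
    have "\<pi> (f' \<ominus>\<^bsub>B\<^esub> f) \<in> (\<lambda>f. \<pi> f) ` F n"
      using x(2)[of n] minus_M[OF f'(1), of f] f f'(2) by simp
    then obtain g where g: "g \<in> F n" "\<pi> (f' \<ominus>\<^bsub>B\<^esub> f) = \<pi> g" by auto
    have gc: "g \<in> carrier B" by (rule ps_order_ge_carrier[OF g(1)])
    have "\<pi> (g \<oplus>\<^bsub>B\<^esub> f) = \<pi> ((f' \<ominus>\<^bsub>B\<^esub> f) \<oplus>\<^bsub>B\<^esub> f)"
      using f f' g gc add_M[OF gc, of f] add_M[of "f' \<ominus>\<^bsub>B\<^esub> f" f] by simp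
    then have "\<pi> (g \<oplus>\<^bsub>B\<^esub> f) = x (Suc n)" using f f' B.minus_add_cancel by simp
    moreover have "(g \<oplus>\<^bsub>B\<^esub> f) \<ominus>\<^bsub>B\<^esub> f = g"
      using f gc by (simp add: a_minus_def B.a_assoc B.r_neg)
    ultimately show "\<exists>h. (h \<in> carrier B \<and> \<pi> h = x (Suc n)) \<and> h \<ominus>\<^bsub>B\<^esub> f \<in> F n"
      using f gc g(1) by (intro exI[of _ "g \<oplus>\<^bsub>B\<^esub> f"]) simp
  qed
  then obtain f where f: "\<And>n. f n \<in> carrier B" "\<And>n. \<pi> (f n) = x n"
    "\<And>n. f (Suc n) \<ominus>\<^bsub>B\<^esub> f n \<in> F n" by blast
  obtain g where g: "g \<in> carrier B" "\<And>n. g \<ominus>\<^bsub>B\<^esub> f n \<in> F n"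
    using cring.ps_Cauchy_convergent[OF M_cring, of f k 0] f(1,3) by auto
  have "\<pi> g \<ominus>\<^bsub>M\<^esub> x n \<in> (\<lambda>f. \<pi> f) ` F n" for n
    using minus_M[OF g(1) f(1)[of n]] f(2) g(2) by simp
  then show "\<exists>y\<in>carrier M. \<forall>n. y \<ominus>\<^bsub>M\<^esub> x n \<in> (\<lambda>f. \<pi> f) ` F n"
    using pi_M[OF g(1)] by blast
qed

text \<open>The series for which one step of successive approximation at level \<open>n\<close>
  succeeds: coefficients of order \<open>n\<close> leave an error in the next filtration
  step.\<close>

definition approx :: "(nat multiset \<Rightarrow> 's) set \<Rightarrow> nat \<Rightarrow> (nat multiset \<Rightarrow> 's) set" where
  "approx Y n = {f \<in> carrier B.
    \<exists>a \<in> Y \<rightarrow> ps_order_ge R k n. f \<ominus>\<^bsub>B\<^esub> lincomb B \<phi> Y a \<in> N (Suc n)}"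

lemma approx_add:
  assumes Y: "Y \<subseteq> carrier B" and f: "f \<in> approx Y n" and g: "g \<in> approx Y n"
  shows "f \<oplus>\<^bsub>B\<^esub> g \<in> approx Y n"
proof -
  interpret N: ideal "N (Suc n)" B by (rule N_ideal)
  interpret F: ideal "ps_order_ge R k n" A by (rule cring.ps_order_ge_ideal[OF R_cring])
  obtain a b where a: "a \<in> Y \<rightarrow> ps_order_ge R k n" "f \<ominus>\<^bsub>B\<^esub> lincomb B \<phi> Y a \<in> N (Suc n)"
    and b: "b \<in> Y \<rightarrow> ps_order_ge R k n" "g \<ominus>\<^bsub>B\<^esub> lincomb B \<phi> Y b \<in> N (Suc n)"
    and fg: "f \<in> carrier B" "g \<in> carrier B"
    using f g unfolding approx_def by blast
  have ac: "a \<in> Y \<rightarrow> carrier A" "b \<in> Y \<rightarrow> carrier A" using a(1) b(1) ps_order_ge_carrier by blast+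
  note l = phi.lincomb_closed[OF Y ac(1)] phi.lincomb_closed[OF Y ac(2)]
  have "(f \<oplus>\<^bsub>B\<^esub> g) \<ominus>\<^bsub>B\<^esub> lincomb B \<phi> Y (\<lambda>y. a y \<oplus>\<^bsub>A\<^esub> b y) =
      (f \<ominus>\<^bsub>B\<^esub> lincomb B \<phi> Y a) \<oplus>\<^bsub>B\<^esub> (g \<ominus>\<^bsub>B\<^esub> lincomb B \<phi> Y b)"
    using fg l by (simp add: phi.lincomb_add[OF Y ac] a_minus_def B.minus_add B.a_ac)
  also have "\<dots> \<in> N (Suc n)" using a(2) b(2) by (rule N.a_closed)
  finally have "(f \<oplus>\<^bsub>B\<^esub> g) \<ominus>\<^bsub>B\<^esub> lincomb B \<phi> Y (\<lambda>y. a y \<oplus>\<^bsub>A\<^esub> b y) \<in> N (Suc n)" .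
  moreover have "(\<lambda>y. a y \<oplus>\<^bsub>A\<^esub> b y) \<in> Y \<rightarrow> ps_order_ge R k n" using a(1) b(1) by auto
  ultimately show ?thesis unfolding approx_def using fg by blast
qed

text \<open>A scalar of order \<open>j\<close> raises the order of the coefficients and that of the
  error alike; the part of the error in \<open>I\<close> stays there. The case \<open>j = 1\<close>
  drives the induction on the level, and \<open>j = 0\<close> gives closure under scalars.\<close>

lemma approx_smult:
  assumes Y: "Y \<subseteq> carrier B" and b: "b \<in> ps_order_ge R k j" and f: "f \<in> approx Y n"
  shows "\<phi> b \<otimes>\<^bsub>B\<^esub> f \<in> approx Y (j + n)"
proof -
  obtain a where a: "a \<in> Y \<rightarrow> ps_order_ge R k n" "f \<ominus>\<^bsub>B\<^esub> lincomb B \<phi> Y a \<in> N (Suc n)"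
    and fc: "f \<in> carrier B"
    using f unfolding approx_def by blast
  have ac: "a \<in> Y \<rightarrow> carrier A" using a(1) ps_order_ge_carrier by blast
  have bc: "b \<in> carrier A" by (rule ps_order_ge_carrier[OF b])
  have l: "lincomb B \<phi> Y a \<in> carrier B" by (rule phi.lincomb_closed[OF Y ac])
  obtain i g where ig: "i \<in> I" "g \<in> F (Suc n)" "f \<ominus>\<^bsub>B\<^esub> lincomb B \<phi> Y a = i \<oplus>\<^bsub>B\<^esub> g"
    using a(2) by (rule NE)
  have gc: "g \<in> carrier B" by (rule ps_order_ge_carrier[OF ig(2)])
  have "\<phi> b \<otimes>\<^bsub>B\<^esub> f \<ominus>\<^bsub>B\<^esub> lincomb B \<phi> Y (\<lambda>y. b \<otimes>\<^bsub>A\<^esub> a y) = \<phi> b \<otimes>\<^bsub>B\<^esub> (f \<ominus>\<^bsub>B\<^esub> lincomb B \<phi> Y a)"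
    using fc l bc by (simp add: phi.lincomb_smult[OF Y ac bc] a_minus_def B.r_distr B.r_minus)
  also have "\<dots> = \<phi> b \<otimes>\<^bsub>B\<^esub> i \<oplus>\<^bsub>B\<^esub> \<phi> b \<otimes>\<^bsub>B\<^esub> g"
    using ig(3) I.Icarr[OF ig(1)] gc bc by (simp add: B.r_distr)
  also have "\<dots> \<in> N (Suc (j + n))"
  proof -
    have "\<phi> b \<otimes>\<^bsub>B\<^esub> i \<in> I" using ig(1) bc by (intro I.I_l_closed) auto
    moreover have "\<phi> b \<otimes>\<^bsub>B\<^esub> g \<in> F (Suc (j + n))"
      using cring.ps_mult_order_ge[OF M_cring phi_order[OF b] ig(2)] by simp
    ultimately show ?thesis unfolding N_def set_add_def' by blast
  qed
  finally have "\<phi> b \<otimes>\<^bsub>B\<^esub> f \<ominus>\<^bsub>B\<^esub> lincomb B \<phi> Y (\<lambda>y. b \<otimes>\<^bsub>A\<^esub> a y) \<in> N (Suc (j + n))" .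
  moreover have "(\<lambda>y. b \<otimes>\<^bsub>A\<^esub> a y) \<in> Y \<rightarrow> ps_order_ge R k (j + n)"
    using a(1) cring.ps_mult_order_ge[OF R_cring b] by blast
  moreover have "\<phi> b \<otimes>\<^bsub>B\<^esub> f \<in> carrier B" using bc fc by simp
  ultimately show ?thesis unfolding approx_def by blast
qed

lemma N_subset_approx:
  assumes Y: "Y \<subseteq> carrier B"
  shows "N (Suc n) \<subseteq> approx Y n"
proof
  fix f assume f: "f \<in> N (Suc n)"
  interpret F: ideal "ps_order_ge R k n" A by (rule cring.ps_order_ge_ideal[OF R_cring])
  have "f \<ominus>\<^bsub>B\<^esub> lincomb B \<phi> Y (\<lambda>y. \<zero>\<^bsub>A\<^esub>) = f"
    using N_carrier[OF f] by (simp add: phi.lincomb_zero[OF Y] a_minus_def)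
  then show "f \<in> approx Y n"
    unfolding approx_def using f N_carrier[OF f] F.zero_closed
    by (intro CollectI conjI bexI[of _ "\<lambda>y. \<zero>\<^bsub>A\<^esub>"]) auto
qed

lemma generators_approx:
  assumes Y: "finite Y" "Y \<subseteq> carrier B"
  shows "Y \<subseteq> approx Y 0"
proof
  fix y assume y: "y \<in> Y"
  then have yc: "y \<in> carrier B" using Y by blast
  have "lincomb B \<phi> Y (\<lambda>x. if x = y then \<one>\<^bsub>A\<^esub> else \<zero>\<^bsub>A\<^esub>) = y"
    using phi.lincomb_single[OF Y y, of "\<one>\<^bsub>A\<^esub>"] yc by simp
  moreover have "y \<ominus>\<^bsub>B\<^esub> y \<in> N (Suc 0)"
    using yc subsetD[OF I_subset_N I.zero_closed] by (simp add: a_minus_def B.r_neg)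
  ultimately show "y \<in> approx Y 0"
    unfolding approx_def using yc
    by (intro CollectI conjI bexI[of _ "\<lambda>x. if x = y then \<one>\<^bsub>A\<^esub> else \<zero>\<^bsub>A\<^esub>"]) auto
qed

text \<open>An element of \<open>N (Suc n)\<close> is, up to \<open>I\<close>, a sum of variables
  times elements of \<open>F n\<close>; each variable lifts an approximation of level
  \<open>n\<close> to level \<open>Suc n\<close>. Generation modulo \<open>\<aa>M\<close> is thus
  enough for all levels.\<close>

lemma N_subset_approx_if_carrier_approx:
  assumes Y: "Y \<subseteq> carrier B" and base: "carrier B \<subseteq> approx Y 0"
  shows "N n \<subseteq> approx Y n"
proof (induction n)
  case 0
  then show ?case using N_carrier base by blast
next
  case (Suc n)
  show ?case
  proof
    fix f assume "f \<in> N (Suc n)"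
    then obtain i h where ih: "i \<in> I" "h \<in> F (Suc n)" "f = i \<oplus>\<^bsub>B\<^esub> h" by (rule NE)
    obtain g where g: "g \<in> {1..k} \<rightarrow> F n"
      "h = (\<Oplus>\<^bsub>B\<^esub>i\<in>{1..k}. ps_var S i \<otimes>\<^bsub>B\<^esub> g i)"
      using cring.ps_order_ge_Suc_decompose[OF M_cring ih(2)] by blast
    have "h \<in> approx Y (Suc n)"
      unfolding g(2)
    proof (rule B.finsum_mem)
      show "approx Y (Suc n) \<subseteq> carrier B" by (auto simp: approx_def)
      show "\<zero>\<^bsub>B\<^esub> \<in> approx Y (Suc n)"
        using N_subset_approx[OF Y] I_subset_N I.zero_closed by blast
    next
      fix i assume i: "i \<in> {1..k}"
      have "g i \<in> approx Y n" using g(1) i F_subset_N Suc by blast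
      then show "ps_var S i \<otimes>\<^bsub>B\<^esub> g i \<in> approx Y (Suc n)"
        using approx_smult[OF Y cring.ps_var_order[OF R_cring i]] by (simp add: phi_var)
    qed (rule approx_add[OF Y])
    moreover have "i \<in> approx Y (Suc n)" using N_subset_approx[OF Y] I_subset_N ih(1) by blast
    ultimately show "f \<in> approx Y (Suc n)" unfolding ih(3) by (intro approx_add[OF Y])
  qed
qed

text \<open>The limit of the approximations differs from the given element by a series in every
  \<open>N n\<close>, hence by one in \<open>I\<close>.\<close>

lemma carrier_M_generated:
  assumes noeth: "noetherian_ring S"
    and Y: "Y \<subseteq> carrier B" and base: "carrier B \<subseteq> approx Y 0"
  shows "carrier M = gen_submodule A M ((\<lambda>f. \<pi> f) ` Y)"
proof
  have Y_M: "(\<lambda>f. \<pi> f) ` Y \<subseteq> carrier M" using Y pi_M by blast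
  then show "gen_submodule A M ((\<lambda>f. \<pi> f) ` Y) \<subseteq> carrier M"
    by (rule MM.gen_submodule_minimal[OF MM.carrier_is_submodule])
  show "carrier M \<subseteq> gen_submodule A M ((\<lambda>f. \<pi> f) ` Y)" (is "_ \<subseteq> ?G")
  proof
    fix x assume "x \<in> carrier M"
    then obtain f where f: "f \<in> carrier B" "x = \<pi> f" by (auto simp: carrier_M)
    have N0: "f \<in> N 0" using F_subset_N[of 0] f(1) by auto
    \<comment> \<open>No order is lost here, so \<open>c = 0\<close>: the coefficients of the step
      at level \<open>n\<close> have order \<open>n\<close>.\<close>
    have "\<exists>a \<in> Y \<rightarrow> carrier A. \<forall>n. \<exists>u \<in> N n. (f \<ominus>\<^bsub>B\<^esub> lincomb B \<phi> Y a) \<ominus>\<^bsub>B\<^esub> u \<in> F (n - 0)"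
    proof (rule topological_Nakayama[where N = N, OF R_cring M_cring phi.ring_hom_cring_axioms phi_order Y _ _ N0])
      show "N n \<subseteq> carrier B" for n using N_carrier by blast
      show "\<exists>a \<in> Y \<rightarrow> ps_order_ge R k (n - 0). g \<ominus>\<^bsub>B\<^esub> lincomb B \<phi> Y a \<in> N (Suc n)"
        if "g \<in> N n" for n g
        using N_subset_approx_if_carrier_approx[OF Y base] that unfolding approx_def by auto
    qed
    then obtain a where a: "a \<in> Y \<rightarrow> carrier A"
      "\<And>n. \<exists>u \<in> N n. (f \<ominus>\<^bsub>B\<^esub> lincomb B \<phi> Y a) \<ominus>\<^bsub>B\<^esub> u \<in> F n" by auto
    have l: "lincomb B \<phi> Y a \<in> carrier B" by (rule phi.lincomb_closed[OF Y a(1)])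
    have "f \<ominus>\<^bsub>B\<^esub> lincomb B \<phi> Y a \<in> N n" for n
    proof -
      interpret N: ideal "N n" B by (rule N_ideal)
      obtain u where u: "u \<in> N n" "(f \<ominus>\<^bsub>B\<^esub> lincomb B \<phi> Y a) \<ominus>\<^bsub>B\<^esub> u \<in> F n" using a(2) by blast
      then have "((f \<ominus>\<^bsub>B\<^esub> lincomb B \<phi> Y a) \<ominus>\<^bsub>B\<^esub> u) \<oplus>\<^bsub>B\<^esub> u \<in> N n"
        using F_subset_N by (intro N.a_closed) auto
      then show ?thesis using B.minus_add_cancel f(1) l N_carrier[OF u(1)] by simp
    qed
    then have "f \<ominus>\<^bsub>B\<^esub> lincomb B \<phi> Y a \<in> I" using N_separated[OF noeth] f(1) l by simp
    then have "x = \<pi> (lincomb B \<phi> Y a)" using pi_eq_iff f l by simp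
    moreover have "lincomb B \<phi> Y a \<in> {f \<in> carrier B. \<pi> f \<in> ?G}"
    proof (rule phi.lincomb_mem)
      have G: "submodule ?G A M" by (rule MM.gen_submodule_submodule[OF Y_M])
      show "\<zero>\<^bsub>B\<^esub> \<in> {f \<in> carrier B. \<pi> f \<in> ?G}"
        using MM.submodule_zero[OF G] zero_M by simp
      show "f \<oplus>\<^bsub>B\<^esub> g \<in> {f \<in> carrier B. \<pi> f \<in> ?G}"
        if "f \<in> {f \<in> carrier B. \<pi> f \<in> ?G}" "g \<in> {f \<in> carrier B. \<pi> f \<in> ?G}" for f g
        using that MM.submoduleE(5)[OF G, of "\<pi> f" "\<pi> g"] by (simp add: add_M)
      show "\<phi> (a y) \<otimes>\<^bsub>B\<^esub> y \<in> {f \<in> carrier B. \<pi> f \<in> ?G}" if y: "y \<in> Y" for y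
      proof -
        have c: "a y \<in> carrier A" "y \<in> carrier B" using a(1) Y y by auto
        have "\<pi> y \<in> ?G" using MM.gen_submodule_incl y by blast
        then show ?thesis using MM.submoduleE(4)[OF G c(1), of "\<pi> y"] smult_M[OF c] c by simp
      qed
    qed auto
    ultimately show "x \<in> ?G" by simp
  qed
qed

text \<open>\<open>Y\<close> lifts finitely many generators of \<open>M/\<aa>M\<close>. Elements of
  the generated submodule are never written out as combinations: the image of
  \<open>approx Y 0\<close> is a submodule containing the generators, so by minimality it is
  everything.\<close>

lemma exists_finite_approx:
  assumes "fin_gen_module (A Quot \<aa>) (quot_module_red M (ideal_smult A M \<aa>))"
  shows "\<exists>Y \<subseteq> carrier B. finite Y \<and> carrier B \<subseteq> approx Y 0"
proof -
  let ?U = "(\<lambda>f. \<pi> f) ` F 1"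
  let ?Q = "quot_module_red M ?U"
  let ?p = "\<lambda>f. ?U +>\<^bsub>M\<^esub> \<pi> f"
  \<comment> \<open>The hypothesis includes the module axioms for the quotient over the residue
    ring, so they need not be derived from the coset operations.\<close>
  interpret fg: fin_gen_module "A Quot \<aa>" ?Q
    using assms unfolding ideal_smult_eq .
  have U: "submodule ?U A M" by (rule pi_F_submodule)
  interpret U: abelian_subgroup ?U M by (rule MM.submodule_abelian_subgroup[OF U])
  interpret aa: ideal \<aa> A by (rule cring.var_ideal_ideal[OF R_cring])
  have carrier_Q: "carrier ?Q = ?p ` carrier B"
    unfolding quot_module_red_def A_RCOSETS_def' by (simp add: carrier_M UNION_singleton_eq_range image_image)
  have add_Q: "?p f \<oplus>\<^bsub>?Q\<^esub> ?p g = ?p (f \<oplus>\<^bsub>B\<^esub> g)" if "f \<in> carrier B" "g \<in> carrier B" for f g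
    using U.a_rcos_sum[OF pi_M[OF that(1)] pi_M[OF that(2)]] that
    by (simp add: quot_module_red_def add_M)
  have zero_Q: "\<zero>\<^bsub>?Q\<^esub> = ?p \<zero>\<^bsub>B\<^esub>"
    using U.a_rcos_const[OF U.zero_closed] by (simp add: quot_module_red_def zero_M)
  have eq_Q: "?p f = ?p g \<longleftrightarrow> f \<ominus>\<^bsub>B\<^esub> g \<in> N 1" if "f \<in> carrier B" "g \<in> carrier B" for f g
    using U.a_rcos_eq_iff[OF pi_M[OF that(1)] pi_M[OF that(2)]] minus_M[OF that]
      pi_N_iff[of "f \<ominus>\<^bsub>B\<^esub> g" 1] that by simp
  have smult_Q: "(\<aa> +>\<^bsub>A\<^esub> a) \<odot>\<^bsub>?Q\<^esub> ?p f = ?p (\<phi> a \<otimes>\<^bsub>B\<^esub> f)"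
    if a: "a \<in> carrier A" and f: "f \<in> carrier B" for a f
  proof -
    have "rcoset_smult M ?U (\<aa> +>\<^bsub>A\<^esub> a) (?U +>\<^bsub>M\<^esub> \<pi> f) = ?U +>\<^bsub>M\<^esub> (a \<odot>\<^bsub>M\<^esub> \<pi> f)"
    proof (rule MM.rcoset_smult_rcos[OF U _ aa.a_rcos_self[OF a] pi_M[OF f]])
      show "\<aa> +>\<^bsub>A\<^esub> a \<subseteq> carrier A" using aa.a_elemrcos_carrier[OF a] by blast
      fix b assume b: "b \<in> \<aa> +>\<^bsub>A\<^esub> a"
      have bc: "b \<in> carrier A" by (rule aa.a_elemrcos_carrier[OF a b])
      have "b \<ominus>\<^bsub>A\<^esub> a \<in> \<aa>" using aa.a_rcos_module[OF a bc] b by (simp add: a_minus_def)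
      then have "(b \<ominus>\<^bsub>A\<^esub> a) \<odot>\<^bsub>M\<^esub> \<pi> f \<in> ideal_smult A M \<aa>"
        unfolding ideal_smult_def
        by (intro subsetD[OF MM.gen_submodule_incl]) (use pi_M[OF f] in blast)
      then show "(b \<ominus>\<^bsub>A\<^esub> a) \<odot>\<^bsub>M\<^esub> \<pi> f \<in> ?U" unfolding ideal_smult_eq .
    qed
    then show ?thesis using smult_M[OF a f] by (simp add: quot_module_red_def)
  qed
  obtain X where X: "X \<subseteq> carrier ?Q" "finite X" "carrier ?Q = gen_submodule (A Quot \<aa>) ?Q X"
    using fg.finitely_generated by blast
  from finite_subset_image[OF X(2) X(1)[unfolded carrier_Q]]
  obtain Y where Y: "Y \<subseteq> carrier B" "finite Y" "X = ?p ` Y" by (elim exE conjE)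
  have approx_B: "f \<in> carrier B" if "f \<in> approx Y 0" for f using that by (simp add: approx_def)
  have smult: "r \<odot>\<^bsub>?Q\<^esub> x \<in> ?p ` approx Y 0"
    if r: "r \<in> carrier (A Quot \<aa>)" and x: "x \<in> ?p ` approx Y 0" for r x
  proof -
    have "carrier (A Quot \<aa>) = (\<lambda>a. \<aa> +>\<^bsub>A\<^esub> a) ` carrier A"
      unfolding FactRing_def A_RCOSETS_def' by (simp add: UNION_singleton_eq_range)
    then obtain a where a: "a \<in> carrier A" "r = \<aa> +>\<^bsub>A\<^esub> a"
      using r by blast
    obtain f where f: "f \<in> approx Y 0" "x = ?p f" using x by blast
    have "\<phi> a \<otimes>\<^bsub>B\<^esub> f \<in> approx Y 0" using approx_smult[OF Y(1), of a 0 f 0] a(1) f(1) by simp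
    then show ?thesis unfolding a(2) f(2) smult_Q[OF a(1) approx_B[OF f(1)]] by blast
  qed
  have "submodule (?p ` approx Y 0) (A Quot \<aa>) ?Q"
  proof (rule fg.submoduleI)
    show sub: "?p ` approx Y 0 \<subseteq> carrier ?Q" unfolding carrier_Q using approx_B by blast
    have "\<zero>\<^bsub>B\<^esub> \<in> approx Y 0" using N_subset_approx[OF Y(1)] I_subset_N I.zero_closed by blast
    then show "\<zero>\<^bsub>?Q\<^esub> \<in> ?p ` approx Y 0" unfolding zero_Q by blast
    show "\<ominus>\<^bsub>?Q\<^esub> x \<in> ?p ` approx Y 0" if x: "x \<in> ?p ` approx Y 0" for x
    proof -
      have xQ: "x \<in> carrier ?Q" using sub x by blast
      have "\<ominus>\<^bsub>?Q\<^esub> x = (\<ominus>\<^bsub>A Quot \<aa>\<^esub> \<one>\<^bsub>A Quot \<aa>\<^esub>) \<odot>\<^bsub>?Q\<^esub> x"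
        using fg.smult_l_minus[OF fg.R.one_closed xQ] fg.smult_one[OF xQ] by simp
      then show ?thesis using smult[OF _ x] by simp
    qed
    show "x \<oplus>\<^bsub>?Q\<^esub> y \<in> ?p ` approx Y 0" if "x \<in> ?p ` approx Y 0" "y \<in> ?p ` approx Y 0" for x y
    proof -
      obtain f g where fg: "f \<in> approx Y 0" "g \<in> approx Y 0" "x = ?p f" "y = ?p g"
        using \<open>x \<in> _\<close> \<open>y \<in> _\<close> by blast
      show ?thesis unfolding fg(3,4) add_Q[OF approx_B[OF fg(1)] approx_B[OF fg(2)]]
        using approx_add[OF Y(1) fg(1,2)] by blast
    qed
  qed (rule smult)
  then have sub: "carrier ?Q \<subseteq> ?p ` approx Y 0"
    unfolding X(3) by (rule fg.gen_submodule_minimal) (use generators_approx[OF Y(2,1)] Y(3) in blast)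
  have "carrier B \<subseteq> approx Y 0"
  proof
    fix f assume f: "f \<in> carrier B"
    then have "?p f \<in> ?p ` approx Y 0" using sub unfolding carrier_Q by blast
    then obtain g where g: "g \<in> approx Y 0" "?p f = ?p g" by blast
    have gc: "g \<in> carrier B" by (rule approx_B[OF g(1)])
    have "f \<ominus>\<^bsub>B\<^esub> g \<in> N (Suc 0)" using eq_Q[OF f gc] g(2) by simp
    \<comment> \<open>\<open>approx Y 0\<close> contains \<open>N 1\<close>, the preimage of
      \<open>\<aa>M\<close>, so equality of cosets is enough to return from the quotient to
      series.\<close>
    then have "f \<ominus>\<^bsub>B\<^esub> g \<in> approx Y 0" using N_subset_approx[OF Y(1)] by blast
    then have "(f \<ominus>\<^bsub>B\<^esub> g) \<oplus>\<^bsub>B\<^esub> g \<in> approx Y 0" using g(1) by (rule approx_add[OF Y(1)])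
    then show "f \<in> approx Y 0" using B.minus_add_cancel[OF f gc] by simp
  qed
  then show ?thesis using Y by blast
qed

end

theorem propositionA5:
  fixes R :: "('r, 'x) ring_scheme" and S :: "('r, 's, 'y) module_scheme" and k :: nat
    and I :: "(nat multiset \<Rightarrow> 's) set"
  defines "A \<equiv> power_series R k"
    and "\<aa> \<equiv> var_ideal R k"
    and "M \<equiv> module_along (power_series S k Quot I)
      (\<lambda>f. I +>\<^bsub>power_series S k\<^esub> ps_structure_map S f)"
  assumes "noetherian_ring R" and "noetherian_ring S" and "algebra R S"
    and "ideal I (power_series S k)"
    and "fin_gen_module (A Quot \<aa>) (quot_module_red M (ideal_smult A M \<aa>))"
  shows "fin_gen_module A M \<and> adically_complete A M \<aa>"
proof -
  interpret ps_quotient R S k I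
    using assms(6,7) by (intro ps_quotient.intro ps_quotient_axioms.intro)
  obtain Y where Y: "Y \<subseteq> carrier B" "finite Y" "carrier B \<subseteq> approx Y 0"
    using exists_finite_approx assms(8) unfolding A_def M_def \<aa>_def by blast
  have "fin_gen_module A M"
    unfolding A_def M_def
  proof (intro fin_gen_module.intro fin_gen_module_axioms.intro MM.module_axioms exI conjI)
    show "finite ((\<lambda>f. I +>\<^bsub>power_series S k\<^esub> f) ` Y)" using Y(2) by simp
  qed (use carrier_M_generated[OF assms(5) Y(1,3)] Y(1) pi_M in auto)
  then show ?thesis
    using adically_complete[OF assms(5)] unfolding A_def M_def \<aa>_def by blast
qed

end
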